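(* Let $f\in BV_{||0||}(\mathbb{R}^2)$. Then, for all real $\xi\neq0$ and $\eta\neq0$, the KP-Fourier transform of $f$ at $(\xi,\eta)$ is well defined and $$\mathcal{F}(f)(\xi,\eta)=-\frac{1}{\xi\eta}\iint_{\mathbb{R}^2}e^{-i(\xi t_1+\eta t_2)}\,df(t_1,t_2),$$ where the right-hand integral is an improper Riemann–Stieltjes integral.
   Context: For a real function $f$ and points $x_{i-1}\le x_i$, $y_{j-1}\le y_j$ put $\Delta f(x_i,y_j)=f(x_i,y_j)-f(x_{i-1},y_j)-f(x_i,y_{j-1})+f(x_{i-1},y_{j-1})$. A partition of a compact rectangle $R=[a,b]\times[c,d]$ is a finite grid of cells $R_{i,j}=[x_{i-1},x_i]\times[y_{j-1},y_j]$ with $a=x_0<\dots<x_n=b$, $c=y_0<\dots<y_m=d$; its norm is the maximum of the diagonal lengths of the cells. A function $f:\mathbb{R}^2\to\mathbb{R}$ is of bounded variation in the Vitali sense, $f\in BV_V(\mathbb{R}^2)$, if $Var(f,\mathbb{R}^2)=\sup_R\sup\sum_{i,j}|\Delta f(x_i,y_j)|<\infty$, the suprema being over compact rectangles $R\subset\mathbb{R}^2$ and partitions of $R$. $BV_{||0||}(\mathbb{R}^2)$ is the set of $f\in BV_V(\mathbb{R}^2)$ with $\lim_{\|(x,y)\|\to\infty}f(x,y)=0$. Riemann–Stieltjes integral: $\iint_R g\,df=A$ means that for every $\varepsilon>0$ there is $\delta>0$ such that $|\sum_{i,j}g(\eta_{i,j},\tau_{i,j})\Delta f(x_i,y_j)-A|<\varepsilon$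 for every partition of $R$ of norm $<\delta$ and all tags $(\eta_{i,j},\tau_{i,j})\in R_{i,j}$; for complex $g$ integrate real and imaginary parts. The improper integral $\iint_{\mathbb{R}^2}g\,df$ is the limit of $\iint_{[a,b]\times[c,d]}g\,df$ as $a,c\to-\infty$, $b,d\to\infty$ in the Pringsheim sense (joint limit, the four variables tending independently). The KP-Fourier transform of $f$ at $(\xi,\eta)$ is $$\mathcal F(f)(\xi,\eta)=\lim_{\substack{a,c\to-\infty\\ b,d\to\infty}}\iint_{[a,b]\times[c,d]}f(t_1,t_2)e^{-i(\xi t_1+\eta t_2)}\,d(t_1,t_2),$$ when this limit exists in the Pringsheim sense; the integrals over compact rectangles are Kurzweil–Henstock integrals (agreeing with the Lebesgue integral for Lebesgue integrable integrands). *)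

theory Defs
  imports "HOL-Analysis.Analysis"
begin

definition incr :: "(real \<times> real \<Rightarrow> real) \<Rightarrow> (nat \<Rightarrow> real) \<Rightarrow> (nat \<Rightarrow> real) \<Rightarrow> nat \<Rightarrow> nat \<Rightarrow> real" where
  "incr f x y i j = f (x (Suc i), y (Suc j)) - f (x i, y (Suc j)) - f (x (Suc i), y j) + f (x i, y j)"

text \<open>A compact rectangle [a, b] x [c, d] is encoded by the tuple (a, b, c, d).\<close>

type_synonym rect = "real \<times> real \<times> real \<times> real"

definition rects :: "rect set" where
  "rects = {(a, b, c, d). a < b \<and> c < d}"

text \<open>
  A grid is encoded by (n, x, m, y), where only x 0, ..., x n and y 0, ..., y m matter.
  The cells are indexed from 0: cell (i, j), for i < n and j < m, is
  [x i, x (i + 1)] x [y j, y (j + 1)].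
\<close>

type_synonym grid = "nat \<times> (nat \<Rightarrow> real) \<times> nat \<times> (nat \<Rightarrow> real)"

fun partitions :: "rect \<Rightarrow> grid set" where
  "partitions (a, b, c, d) = {(n, x, m, y).
     x 0 = a \<and> x n = b \<and> (\<forall>i<n. x i < x (Suc i)) \<and>
     y 0 = c \<and> y m = d \<and> (\<forall>j<m. y j < y (Suc j))}"

fun cell :: "grid \<Rightarrow> nat \<Rightarrow> nat \<Rightarrow> (real \<times> real) set" where
  "cell (n, x, m, y) i j = {x i..x (Suc i)} \<times> {y j..y (Suc j)}"

fun mesh :: "grid \<Rightarrow> real" where
  "mesh (n, x, m, y) =
     Max ((\<lambda>(i, j). dist (x i, y j) (x (Suc i), y (Suc j))) ` ({..<n} \<times> {..<m}))"

fun variation_sum :: "(real \<times> real \<Rightarrow> real) \<Rightarrow> grid \<Rightarrow> real" where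
  "variation_sum f (n, x, m, y) = (\<Sum>i<n. \<Sum>j<m. \<bar>incr f x y i j\<bar>)"

definition Var :: "(real \<times> real \<Rightarrow> real) \<Rightarrow> ennreal" where
  "Var f = (SUP R\<in>rects. SUP P\<in>partitions R. ennreal (variation_sum f P))"

definition BV_V :: "(real \<times> real \<Rightarrow> real) set" where
  "BV_V = {f. Var f < \<infinity>}"

definition BV_0 :: "(real \<times> real \<Rightarrow> real) set" where
  "BV_0 = {f \<in> BV_V. (f \<longlongrightarrow> 0) at_infinity}"

fun tags :: "grid \<Rightarrow> (nat \<Rightarrow> nat \<Rightarrow> real \<times> real) set" where
  "tags (n, x, m, y) = {t. \<forall>i<n. \<forall>j<m. t i j \<in> cell (n, x, m, y) i j}"

fun RS_sum :: "(real \<times> real \<Rightarrow> real) \<Rightarrow> (real \<times> real \<Rightarrow> real) \<Rightarrow> grid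
    \<Rightarrow> (nat \<Rightarrow> nat \<Rightarrow> real \<times> real) \<Rightarrow> real" where
  "RS_sum g f (n, x, m, y) t = (\<Sum>i<n. \<Sum>j<m. g (t i j) * incr f x y i j)"

definition has_RS_integral_real ::
    "(real \<times> real \<Rightarrow> real) \<Rightarrow> (real \<times> real \<Rightarrow> real) \<Rightarrow> rect \<Rightarrow> real \<Rightarrow> bool" where
  "has_RS_integral_real g f R A \<longleftrightarrow>
     (\<forall>\<epsilon>>0. \<exists>\<delta>>0. \<forall>P\<in>partitions R. mesh P < \<delta> \<longrightarrow>
        (\<forall>t\<in>tags P. \<bar>RS_sum g f P t - A\<bar> < \<epsilon>))"

definition has_RS_integral ::
    "(real \<times> real \<Rightarrow> complex) \<Rightarrow> (real \<times> real \<Rightarrow> real) \<Rightarrow> rect \<Rightarrow> complex \<Rightarrow> bool" where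
  "has_RS_integral g f R A \<longleftrightarrow>
     has_RS_integral_real (\<lambda>z. Re (g z)) f R (Re A) \<and>
     has_RS_integral_real (\<lambda>z. Im (g z)) f R (Im A)"

definition RS_integrable ::
    "(real \<times> real \<Rightarrow> complex) \<Rightarrow> (real \<times> real \<Rightarrow> real) \<Rightarrow> rect \<Rightarrow> bool" where
  "RS_integrable g f R \<longleftrightarrow> (\<exists>A. has_RS_integral g f R A)"

definition RS_integral ::
    "(real \<times> real \<Rightarrow> complex) \<Rightarrow> (real \<times> real \<Rightarrow> real) \<Rightarrow> rect \<Rightarrow> complex" where
  "RS_integral g f R = (THE A. has_RS_integral g f R A)"

text \<open>Pringsheim convergence: in (a, b, c, d), jointly and independently, a and c tend to
  minus infinity while b and d tend to plus infinity.\<close>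

definition pringsheim :: "rect filter" where
  "pringsheim = at_bot \<times>\<^sub>F at_top \<times>\<^sub>F at_bot \<times>\<^sub>F at_top"

definition improper_RS_integrable ::
    "(real \<times> real \<Rightarrow> complex) \<Rightarrow> (real \<times> real \<Rightarrow> real) \<Rightarrow> bool" where
  "improper_RS_integrable g f \<longleftrightarrow>
     (\<forall>R\<in>rects. RS_integrable g f R) \<and> (\<exists>L. (RS_integral g f \<longlongrightarrow> L) pringsheim)"

definition improper_RS_integral ::
    "(real \<times> real \<Rightarrow> complex) \<Rightarrow> (real \<times> real \<Rightarrow> real) \<Rightarrow> complex" where
  "improper_RS_integral g f = Lim pringsheim (RS_integral g f)"

definition fourier_kernel :: "real \<Rightarrow> real \<Rightarrow> real \<times> real \<Rightarrow> complex" where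
  "fourier_kernel \<xi> \<eta> = (\<lambda>(t1, t2). exp (- (\<i> * complex_of_real (\<xi> * t1 + \<eta> * t2))))"

text \<open>The library's \<^const>\<open>integral\<close> is the Kurzweil-Henstock (gauge) integral.\<close>

definition KP_partial ::
    "(real \<times> real \<Rightarrow> real) \<Rightarrow> real \<Rightarrow> real \<Rightarrow> rect \<Rightarrow> complex" where
  "KP_partial f \<xi> \<eta> = (\<lambda>(a, b, c, d).
     integral (cbox (a, c) (b, d)) (\<lambda>t. complex_of_real (f t) * fourier_kernel \<xi> \<eta> t))"

definition KP_fourier_well_defined :: "(real \<times> real \<Rightarrow> real) \<Rightarrow> real \<Rightarrow> real \<Rightarrow> bool" where
  "KP_fourier_well_defined f \<xi> \<eta> \<longleftrightarrow>
     (\<forall>(a, b, c, d)\<in>rects.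
        (\<lambda>t. complex_of_real (f t) * fourier_kernel \<xi> \<eta> t) integrable_on cbox (a, c) (b, d)) \<and>
     (\<exists>L. (KP_partial f \<xi> \<eta> \<longlongrightarrow> L) pringsheim)"

definition KP_fourier :: "(real \<times> real \<Rightarrow> real) \<Rightarrow> real \<Rightarrow> real \<Rightarrow> complex" where
  "KP_fourier f \<xi> \<eta> = Lim pringsheim (KP_partial f \<xi> \<eta>)"

end

theory Submission
  imports Defs
begin

text \<open>
  Let \<open>\<mu> S\<close> be the supremum of \<open>\<Sum>\<bar>\<Delta>f\<bar>\<close> over finite families of disjoint rectangles in \<open>S\<close>;
  it is bounded, superadditive, and small on the complement of a large square.
  Since \<open>f\<close> vanishes at infinity, increments of \<open>f\<close> along horizontal and vertical lines are
  bounded by \<open>\<mu>\<close> of half-strips; in particular \<open>f\<close> is a Lipschitz function of a pair of monotone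
  functions of one coordinate each, hence Borel.
  The Riemann--Stieltjes integral is identified without common refinements: the expression \<open>A R\<close>
  obtained by formally integrating by parts in each variable is additive over grids, and on
  a cell \<open>Q\<close> of diameter \<open>\<delta>\<close> it differs from a Riemann--Stieltjes summand by \<open>O(\<delta> * \<mu> Q)\<close>.
  The same expression satisfies \<open>\<bar>A R\<bar> \<le> \<mu> R\<close>, so it is Cauchy in the Pringsheim sense, and all
  boundary terms in the integration by parts are bounded by \<open>\<mu>\<close> of the complement of a square.
\<close>

section \<open>The variation as a superadditive set function\<close>

fun rinc :: "(real \<times> real \<Rightarrow> real) \<Rightarrow> rect \<Rightarrow> real" where
  "rinc f (a, b, c, d) = f (b, d) - f (a, d) - f (b, c) + f (a, c)"

text \<open>Half-open boxes make neighbouring rectangles disjoint although their closures share an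
  edge, so cutting a rectangle yields a genuine disjoint union.\<close>

fun hrect :: "rect \<Rightarrow> (real \<times> real) set" where
  "hrect (a, b, c, d) = {a<..b} \<times> {c<..d}"

lemma sum_incr:
  assumes "p \<le> q" "r \<le> s"
  shows "(\<Sum>i=p..<q. \<Sum>j=r..<s. incr f x y i j) = rinc f (x p, x q, y r, y s)"
proof -
  have "(\<Sum>j=r..<s. incr f x y i j) =
      (f (x (Suc i), y s) - f (x (Suc i), y r)) - (f (x i, y s) - f (x i, y r))" for i
    using sum_Suc_diff'[OF assms(2), of "\<lambda>j. f (x (Suc i), y j) - f (x i, y j)"]
    by (simp add: incr_def algebra_simps)
  then show ?thesis
    using sum_Suc_diff'[OF assms(1), of "\<lambda>i. f (x i, y s) - f (x i, y r)"]
    by simp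
qed

lemma finite_set_enumeration:
  fixes X :: "real set"
  assumes "finite X" "X \<noteq> {}"
  obtains n :: nat and x :: "nat \<Rightarrow> real"
  where "X = x ` {..n}" "\<And>i j. i \<le> n \<Longrightarrow> j \<le> n \<Longrightarrow> x i < x j \<longleftrightarrow> i < j"
proof -
  define l where "l = sorted_list_of_set X"
  have l: "set l = X" "sorted_wrt (<) l"
    using assms by (auto simp: l_def strict_sorted_list_of_set)
  then have ne: "l \<noteq> []" using assms by auto
  have *: "i < j \<Longrightarrow> j < length l \<Longrightarrow> l ! i < l ! j" for i j
    using l(2) by (simp add: sorted_wrt_iff_nth_less)
  have "{..length l - 1} = {..<length l}"
    using ne by (cases l) auto
  then have "X = (!) l ` {..length l - 1}"
    unfolding l(1)[symmetric] by (auto simp: set_conv_nth)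
  moreover have "l ! i < l ! j \<longleftrightarrow> i < j" if "i \<le> length l - 1" "j \<le> length l - 1" for i j
  proof -
    have "i < length l" "j < length l" using that ne by (cases l; simp)+
    then show ?thesis using *[of i j] *[of j i]
      by (metis less_asym linorder_neqE_nat)
  qed
  ultimately show ?thesis using that by blast
qed

text \<open>The default \<open>enn2real \<infinity> = 0\<close> makes this number meaningful only
  for members of \<open>BV_V\<close>; every bound by \<open>var\<close> carries that
  hypothesis.\<close>

definition var :: "(real \<times> real \<Rightarrow> real) \<Rightarrow> real" where
  "var f = enn2real (Var f)"

lemma variation_sum_le:
  assumes "f \<in> BV_V" "R \<in> rects" "P \<in> partitions R"
  shows "variation_sum f P \<le> var f"
proof -
  have "ennreal (variation_sum f P) \<le> Var f"
    unfolding Var_def using assms(2,3) by (auto intro!: SUP_upper2[of R] SUP_upper2[of P])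
  moreover have "Var f = ennreal (var f)"
    using assms(1) unfolding var_def BV_V_def by (simp add: less_top)
  moreover have "0 \<le> var f" by (simp add: var_def)
  ultimately show ?thesis
    by (metis ennreal_le_iff)
qed

text \<open>Unlike the grids in the definition of the variation, families of pairwise disjoint
  rectangles can be united without any refinement.\<close>

definition packing :: "rect set \<Rightarrow> (real \<times> real) set \<Rightarrow> bool" where
  "packing F S \<longleftrightarrow> finite F \<and> F \<subseteq> rects \<and> disjoint_family_on hrect F \<and> (\<forall>Q\<in>F. hrect Q \<subseteq> S)"

text \<open>All edge coordinates of the family together span one grid. Each rectangle is a block of
  its cells, so its increment telescopes into the cell increments, and disjointness ensures that no
  cell is counted twice.\<close>

lemma packing_sum_le:
  assumes f: "f \<in> BV_V" and F: "packing F S"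
  shows "(\<Sum>Q\<in>F. \<bar>rinc f Q\<bar>) \<le> var f"
proof (cases "F = {}")
  case True
  then show ?thesis by (simp add: var_def)
next
  case False
  have fin: "finite F" and sub: "F \<subseteq> rects" and disj: "disjoint_family_on hrect F"
    using F by (auto simp: packing_def)
  define X where "X = (\<Union>(a, b, c, d)\<in>F. {a, b})"
  define Y where "Y = (\<Union>(a, b, c, d)\<in>F. {c, d})"
  have XY: "finite X" "finite Y" using fin by (auto simp: X_def Y_def)
  have memXY: "a \<in> X" "b \<in> X" "c \<in> Y" "d \<in> Y" if "(a, b, c, d) \<in> F" for a b c d
    using that by (force simp: X_def Y_def)+
  obtain Q where "Q \<in> F" using False by auto
  then obtain a b c d where abcd: "(a, b, c, d) \<in> F" by (cases Q) auto
  then have lt: "a < b" "c < d" using sub by (auto simp: rects_def)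
  have ne: "X \<noteq> {}" "Y \<noteq> {}" using memXY[OF abcd] by auto
  obtain n :: nat and x where x: "X = x ` {..n}" and xm: "\<And>i j. i \<le> n \<Longrightarrow> j \<le> n \<Longrightarrow> x i < x j \<longleftrightarrow> i < j"
    by (rule finite_set_enumeration[OF XY(1) ne(1)]) blast
  obtain m :: nat and y where y: "Y = y ` {..m}" and ym: "\<And>i j. i \<le> m \<Longrightarrow> j \<le> m \<Longrightarrow> y i < y j \<longleftrightarrow> i < j"
    by (rule finite_set_enumeration[OF XY(2) ne(2)]) blast
  have "n > 0" using x lt memXY[OF abcd] by (cases n) auto
  moreover have "m > 0" using y lt memXY[OF abcd] by (cases m) auto
  ultimately have R: "(x 0, x n, y 0, y m) \<in> rects"
    by (auto simp: rects_def xm ym)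
  have P: "(n, x, m, y) \<in> partitions (x 0, x n, y 0, y m)"
    using xm ym by simp
  \<comment> \<open>A cell lies in \<open>Q\<close> exactly when its upper right corner lies in the
    half-open box. With this encoding, disjointness of the boxes is at once disjointness of the
    index sets.\<close>
  define J where "J Q = {(i, j). i < n \<and> j < m \<and> (x (Suc i), y (Suc j)) \<in> hrect Q}" for Q
  have finJ: "finite (J Q)" for Q
    by (rule finite_subset[of _ "{..<n} \<times> {..<m}"]) (auto simp: J_def)
  have bd: "\<bar>rinc f Q\<bar> \<le> (\<Sum>(i, j)\<in>J Q. \<bar>incr f x y i j\<bar>)" if Qin: "Q \<in> F" for Q
  proof -
    obtain a b c d where Q: "Q = (a, b, c, d)" by (cases Q) auto
    have lt: "a < b" "c < d" using sub Qin Q by (auto simp: rects_def)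
    obtain p q r s where pq: "a = x p" "b = x q" "c = y r" "d = y s"
        "p \<le> n" "q \<le> n" "r \<le> m" "s \<le> m"
      using memXY[OF Qin[unfolded Q]] x y by auto
    have le: "p < q" "r < s" using lt pq xm ym by auto
    have mono: "x p < x (Suc i) \<longleftrightarrow> p \<le> i" "x (Suc i) \<le> x q \<longleftrightarrow> i < q" if "i < n" for i
      using pq that xm[of p "Suc i"] xm[of q "Suc i"] by (simp_all add: less_Suc_eq_le not_less[of "x q", symmetric] not_le Suc_le_eq)
    have mono': "y r < y (Suc j) \<longleftrightarrow> r \<le> j" "y (Suc j) \<le> y s \<longleftrightarrow> j < s" if "j < m" for j
      using pq that ym[of r "Suc j"] ym[of s "Suc j"] by (simp_all add: less_Suc_eq_le not_less[of "y s", symmetric] not_le Suc_le_eq)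
    have J: "J Q = {p..<q} \<times> {r..<s}"
      using pq(6,8) unfolding J_def Q pq(1-4) by (auto simp: mono mono')
    have "rinc f Q = (\<Sum>i=p..<q. \<Sum>j=r..<s. incr f x y i j)"
      using sum_incr[of p q r s f x y] le by (simp add: Q pq)
    then have "rinc f Q = (\<Sum>(i, j)\<in>J Q. incr f x y i j)"
      by (simp only: J sum.cartesian_product)
    then show ?thesis by (simp add: sum_abs case_prod_unfold)
  qed
  have "(\<Sum>Q\<in>F. \<bar>rinc f Q\<bar>) \<le> (\<Sum>Q\<in>F. \<Sum>(i, j)\<in>J Q. \<bar>incr f x y i j\<bar>)"
    by (intro sum_mono bd)
  also have "\<dots> = (\<Sum>(i, j)\<in>(\<Union>Q\<in>F. J Q). \<bar>incr f x y i j\<bar>)"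
    using disj unfolding disjoint_family_on_def
    by (intro sum.UNION_disjoint[symmetric] fin ballI impI finJ) (unfold J_def, blast)
  also have "\<dots> \<le> (\<Sum>(i, j)\<in>{..<n} \<times> {..<m}. \<bar>incr f x y i j\<bar>)"
    by (intro sum_mono2) (auto simp: J_def)
  also have "\<dots> = variation_sum f (n, x, m, y)"
    by (simp add: sum.cartesian_product)
  also have "\<dots> \<le> var f" by (rule variation_sum_le[OF f R P])
  finally show ?thesis .
qed

section \<open>The set function \<open>varm\<close> and its behaviour at infinity\<close>

text \<open>The \<mu> of the introductory text: an inner variation, defined for arbitrary sets, that
  plays the part of a total variation measure.\<close>

definition varm :: "(real \<times> real \<Rightarrow> real) \<Rightarrow> (real \<times> real) set \<Rightarrow> real" where
  "varm f S = (SUP F\<in>{F. packing F S}. \<Sum>Q\<in>F. \<bar>rinc f Q\<bar>)"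

lemma packing_empty [simp]: "packing {} S"
  by (simp add: packing_def disjoint_family_on_def)

lemma packing_mono: "packing F S \<Longrightarrow> S \<subseteq> T \<Longrightarrow> packing F T"
  by (auto simp: packing_def)

lemma packing_Un:
  assumes F: "packing F S" and G: "packing G T" and ST: "S \<inter> T = {}"
  shows "packing (F \<union> G) (S \<union> T)" "F \<inter> G = {}"
proof -
  show "packing (F \<union> G) (S \<union> T)"
    unfolding packing_def disjoint_family_on_def
  proof (intro conjI ballI impI)
    fix P Q assume PQ: "P \<in> F \<union> G" "Q \<in> F \<union> G" "P \<noteq> Q"
    have "P \<in> F \<Longrightarrow> Q \<in> F \<Longrightarrow> hrect P \<inter> hrect Q = {}"
      "P \<in> G \<Longrightarrow> Q \<in> G \<Longrightarrow> hrect P \<inter> hrect Q = {}"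
      using F G PQ(3) by (simp_all add: packing_def disjoint_family_on_def)
    moreover have "P \<in> F \<Longrightarrow> hrect P \<subseteq> S" "P \<in> G \<Longrightarrow> hrect P \<subseteq> T"
      "Q \<in> F \<Longrightarrow> hrect Q \<subseteq> S" "Q \<in> G \<Longrightarrow> hrect Q \<subseteq> T"
      using F G by (simp_all add: packing_def)
    ultimately show "hrect P \<inter> hrect Q = {}" using PQ(1,2) ST by blast
  qed (use F G in \<open>auto simp: packing_def\<close>)
  \<comment> \<open>A rectangle belonging to both families would have its nonempty half-open box
    inside \<open>S \<inter> T\<close>.\<close>
  have "hrect Q \<noteq> {}" if "Q \<in> F" for Q
    using F that by (cases Q) (auto simp: packing_def rects_def)
  moreover have "hrect Q \<subseteq> S" if "Q \<in> F" for Q using F that by (simp add: packing_def)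
  moreover have "hrect Q \<subseteq> T" if "Q \<in> G" for Q using G that by (simp add: packing_def)
  ultimately show "F \<inter> G = {}" using ST by blast
qed

context
  fixes f :: "real \<times> real \<Rightarrow> real"
  assumes f: "f \<in> BV_V"
begin

lemma varm_bdd: "bdd_above ((\<lambda>F. \<Sum>Q\<in>F. \<bar>rinc f Q\<bar>) ` {F. packing F S})"
  using packing_sum_le[OF f] by (auto simp: bdd_above_def)

lemma varm_upper: "packing F S \<Longrightarrow> (\<Sum>Q\<in>F. \<bar>rinc f Q\<bar>) \<le> varm f S"
  unfolding varm_def by (rule cSUP_upper[OF _ varm_bdd]) simp

lemma varm_least:
  assumes "\<And>F. packing F S \<Longrightarrow> (\<Sum>Q\<in>F. \<bar>rinc f Q\<bar>) \<le> B"
  shows "varm f S \<le> B"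
  unfolding varm_def using packing_empty[of S] assms by (intro cSUP_least) blast+

lemma varm_nonneg: "0 \<le> varm f S"
  using varm_upper[OF packing_empty] by simp

lemma varm_mono: "S \<subseteq> T \<Longrightarrow> varm f S \<le> varm f T"
  by (intro varm_least varm_upper) (rule packing_mono)

lemma varm_empty [simp]: "varm f {} = 0"
proof (rule antisym[OF varm_least varm_nonneg])
  fix F assume F: "packing F {}"
  \<comment> \<open>Applied with both sets empty, the disjointness statement says that
    \<open>F\<close> is disjoint from itself.\<close>
  then have "F = {}" using packing_Un(2)[OF F F] by simp
  then show "(\<Sum>Q\<in>F. \<bar>rinc f Q\<bar>) \<le> 0" by simp
qed

lemma varm_superadd:
  assumes "S \<inter> T = {}"
  shows "varm f S + varm f T \<le> varm f (S \<union> T)"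
proof -
  have *: "(\<Sum>Q\<in>F. \<bar>rinc f Q\<bar>) + (\<Sum>Q\<in>G. \<bar>rinc f Q\<bar>) \<le> varm f (S \<union> T)"
    if "packing F S" "packing G T" for F G
  proof -
    have "(\<Sum>Q\<in>F. \<bar>rinc f Q\<bar>) + (\<Sum>Q\<in>G. \<bar>rinc f Q\<bar>) = (\<Sum>Q\<in>F \<union> G. \<bar>rinc f Q\<bar>)"
      using that packing_Un(2)[OF that assms]
      by (intro sum.union_disjoint[symmetric]) (simp_all add: packing_def)
    then show ?thesis using varm_upper[OF packing_Un(1)[OF that assms]] by simp
  qed
  \<comment> \<open>The supremum is taken over packings of \<open>S\<close> with \<open>G\<close>
    fixed, and afterwards over \<open>G\<close>.\<close>
  have "varm f S \<le> varm f (S \<union> T) - (\<Sum>Q\<in>G. \<bar>rinc f Q\<bar>)" if "packing G T" for G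
    using *[OF _ that] by (intro varm_least) (simp add: le_diff_eq)
  then have "varm f T \<le> varm f (S \<union> T) - varm f S"
    by (intro varm_least) (simp add: le_diff_eq add.commute)
  then show ?thesis by simp
qed

lemma varm_superadd_le: "S \<inter> T = {} \<Longrightarrow> S \<union> T \<subseteq> W \<Longrightarrow> varm f S + varm f T \<le> varm f W"
  using varm_superadd[of S T] varm_mono[of "S \<union> T" W] by simp

lemma varm_sum_le:
  assumes "finite K" "disjoint_family_on S K"
  shows "(\<Sum>k\<in>K. varm f (S k)) \<le> varm f (\<Union>k\<in>K. S k)"
  using assms
proof (induction K)
  case (insert k K)
  have "S k \<inter> (\<Union>k\<in>K. S k) = {}" "disjoint_family_on S K"
    using insert.prems insert.hyps by (simp_all add: disjoint_family_on_insert)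
  then show ?case
    using varm_superadd[of "S k" "\<Union>k\<in>K. S k"] insert.IH insert.hyps by simp
qed simp

lemma rinc_le_varm:
  assumes "a \<le> b" "c \<le> d"
  shows "\<bar>rinc f (a, b, c, d)\<bar> \<le> varm f ({a<..b} \<times> {c<..d})"
proof (cases "a < b \<and> c < d")
  case True
  then have "packing {(a, b, c, d)} ({a<..b} \<times> {c<..d})"
    by (auto simp: packing_def rects_def disjoint_family_on_def)
  from varm_upper[OF this] show ?thesis by simp
next
  case False
  then have "a = b \<or> c = d" using assms by auto
  then show ?thesis using varm_nonneg by auto
qed

text \<open>A finite packing that nearly attains \<open>varm f UNIV\<close> fits into a large
  square, and superadditivity leaves less than \<epsilon> for the complement. Both Pringsheim limits
  below rest on this.\<close>

lemma varm_tail: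
  assumes "\<epsilon> > 0"
  obtains N where "N > 0" "varm f (- ({-N<..N} \<times> {-N<..N})) < \<epsilon>"
proof -
  have "\<exists>F. packing F UNIV \<and> varm f UNIV - \<epsilon> < (\<Sum>Q\<in>F. \<bar>rinc f Q\<bar>)"
  proof (rule ccontr)
    assume "\<not> ?thesis"
    then have "varm f UNIV \<le> varm f UNIV - \<epsilon>"
      by (intro varm_least) force
    then show False using assms by simp
  qed
  then obtain F where F: "packing F UNIV" "varm f UNIV - \<epsilon> < (\<Sum>Q\<in>F. \<bar>rinc f Q\<bar>)"
    by blast
  define M where "M = (\<lambda>(a, b, c, d). \<bar>a\<bar> + \<bar>b\<bar> + \<bar>c\<bar> + \<bar>d\<bar> :: real)"
  define N where "N = 1 + (\<Sum>Q\<in>F. M Q)"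
  have M: "0 \<le> M Q" for Q by (cases Q) (simp add: M_def)
  have "hrect Q \<subseteq> {-N<..N} \<times> {-N<..N}" if "Q \<in> F" for Q
  proof -
    obtain a b c d where Q: "Q = (a, b, c, d)" by (cases Q) auto
    have "M Q < N"
      using member_le_sum[OF that, of M] F(1) M by (simp add: N_def packing_def add_strict_increasing)
    then have "- N \<le> a" "b \<le> N" "- N \<le> c" "d \<le> N"
      unfolding M_def Q by auto
    then show ?thesis unfolding Q by auto
  qed
  then have "packing F ({-N<..N} \<times> {-N<..N})"
    using F(1) by (simp add: packing_def)
  from varm_upper[OF this]
  have "varm f UNIV - \<epsilon> < varm f ({-N<..N} \<times> {-N<..N})" using F(2) by simp
  moreover have "varm f ({-N<..N} \<times> {-N<..N}) + varm f (- ({-N<..N} \<times> {-N<..N})) \<le> varm f UNIV"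
    by (rule varm_superadd_le) auto
  moreover have "N > 0" using sum_nonneg[of F M] M by (simp add: N_def add_pos_nonneg)
  ultimately show ?thesis using that[of N] by linarith
qed

end

section \<open>Stieltjes integration by parts on the line\<close>

definition osc :: "real \<Rightarrow> real \<Rightarrow> complex" where
  "osc k t = exp (- (\<i> * complex_of_real (k * t)))"

lemma norm_osc [simp]: "norm (osc k t) = 1"
  by (simp add: osc_def)

lemma osc_deriv: "(osc k has_vector_derivative - \<i> * complex_of_real k * osc k t) (at t within S)"
proof -
  have d: "((\<lambda>z. exp (- (\<i> * complex_of_real k * z))) has_field_derivative - \<i> * complex_of_real k * exp (- (\<i> * complex_of_real k * of_real t)))
      (at (of_real t))"
    by (rule derivative_eq_intros refl | simp)+
  have o: "osc k s = exp (- (\<i> * complex_of_real k * complex_of_real s))" for s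
    by (simp only: osc_def of_real_mult mult.assoc)
  have o': "osc k = (\<lambda>s. exp (- (\<i> * complex_of_real k * complex_of_real s)))"
    by (rule ext, rule o)
  show ?thesis
    unfolding o' by (rule has_vector_derivative_real_field[OF d])
qed

lemma continuous_on_osc [continuous_intros]: "continuous_on S (osc k)"
  unfolding osc_def by (intro continuous_intros)

lemma osc_integral: "a \<le> b \<Longrightarrow> ((\<lambda>t. - \<i> * k * osc k t) has_integral osc k b - osc k a) {a..b}"
  by (rule fundamental_theorem_of_calculus) (assumption, rule osc_deriv)

lemma norm_has_integral_le:
  fixes g :: "real \<Rightarrow> complex"
  assumes "(g has_integral I) {a..b}" "a \<le> b" "0 \<le> B" "\<And>t. t \<in> {a..b} \<Longrightarrow> norm (g t) \<le> B"
  shows "norm I \<le> B * (b - a)"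
  using has_integral_bound[of B g I a b] assms by (simp add: cbox_interval)

lemma osc_Lipschitz: "norm (osc k s - osc k t) \<le> \<bar>k\<bar> * \<bar>s - t\<bar>"
proof -
  have *: "norm (osc k b - osc k a) \<le> \<bar>k\<bar> * \<bar>b - a\<bar>" if "a \<le> b" for a b
  proof -
    have "norm (osc k b - osc k a) \<le> \<bar>k\<bar> * (b - a)"
      by (rule norm_has_integral_le[OF osc_integral[OF that] that]) (simp_all only: norm_mult abs_ge_zero, simp)
    then show ?thesis using that by simp
  qed
  consider "s \<le> t" | "t \<le> s" by linarith
  then show ?thesis
  proof cases
    case 1
    from *[OF this] show ?thesis by (metis norm_minus_commute abs_minus_commute)
  next
    case 2
    from *[OF this] show ?thesis .
  qed
qed

text \<open>The majorant \<phi> plays the part of the variation function of \<open>u\<close>; it is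
  automatically nondecreasing on \<open>{a..b}\<close>. Leaving it free allows \<open>varm\<close>
  of growing strips to be inserted later.\<close>

definition controls :: "real \<Rightarrow> real \<Rightarrow> (real \<Rightarrow> real) \<Rightarrow> (real \<Rightarrow> 'a::real_normed_vector) \<Rightarrow> bool" where
  "controls a b \<phi> u \<longleftrightarrow> (\<forall>s t. a \<le> s \<longrightarrow> s \<le> t \<longrightarrow> t \<le> b \<longrightarrow> norm (u t - u s) \<le> \<phi> t - \<phi> s)"

lemma controlsI:
  "(\<And>s t. a \<le> s \<Longrightarrow> s \<le> t \<Longrightarrow> t \<le> b \<Longrightarrow> norm (u t - u s) \<le> \<phi> t - \<phi> s) \<Longrightarrow> controls a b \<phi> u"
  by (simp add: controls_def)

lemma controlsD:
  "controls a b \<phi> u \<Longrightarrow> a \<le> s \<Longrightarrow> s \<le> t \<Longrightarrow> t \<le> b \<Longrightarrow> norm (u t - u s) \<le> \<phi> t - \<phi> s"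
  by (simp add: controls_def)

lemma controls_subinterval:
  "controls a b \<phi> u \<Longrightarrow> a \<le> a' \<Longrightarrow> b' \<le> b \<Longrightarrow> controls a' b' \<phi> u"
  by (auto simp: controls_def)

section \<open>Measurability and integrability from a control\<close>

text \<open>The bound makes \<open>u\<close> a function of \<kappa> alone, and this factor is
  Lipschitz on the range of \<kappa>. Continuity relative to the range suffices, since \<kappa> is
  measurable into the restricted space.\<close>

lemma borel_measurable_Lipschitz_factor:
  fixes u :: "'a \<Rightarrow> 'b::{second_countable_topology, metric_space}"
    and \<kappa> :: "'a \<Rightarrow> 'c::{second_countable_topology, metric_space}"
  assumes \<kappa>: "\<kappa> \<in> borel_measurable M"
    and L: "\<And>p q. dist (u p) (u q) \<le> C * dist (\<kappa> p) (\<kappa> q)"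
  shows "u \<in> borel_measurable M"
proof -
  \<comment> \<open>An arbitrary preimage is chosen; the Lipschitz bound gives distance 0 between
    the values of \<open>u\<close> at any two preimages.\<close>
  define h where "h z = u (SOME p. \<kappa> p = z)" for z
  have h: "h (\<kappa> p) = u p" for p
  proof -
    have "\<kappa> (SOME q. \<kappa> q = \<kappa> p) = \<kappa> p" by (rule someI) simp
    then have "dist (h (\<kappa> p)) (u p) \<le> 0"
      using L[of "SOME q. \<kappa> q = \<kappa> p" p] by (simp add: h_def)
    then show ?thesis by simp
  qed
  have "\<bar>C\<bar>-lipschitz_on (range \<kappa>) h"
  proof (rule lipschitz_onI)
    fix y z assume "y \<in> range \<kappa>" "z \<in> range \<kappa>"
    then obtain p q where [simp]: "y = \<kappa> p" "z = \<kappa> q" by auto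
    have "C * dist y z \<le> \<bar>C\<bar> * dist y z" by (intro mult_right_mono) auto
    then show "dist (h y) (h z) \<le> \<bar>C\<bar> * dist y z"
      using L[of p q] by (simp add: h)
  qed simp
  then have "h \<in> borel_measurable (restrict_space borel (range \<kappa>))"
    by (intro borel_measurable_continuous_on_restrict lipschitz_on_continuous_on)
  moreover have "\<kappa> \<in> M \<rightarrow>\<^sub>M restrict_space borel (range \<kappa>)"
    using \<kappa> by (intro measurable_restrict_space2) auto
  ultimately have "(\<lambda>p. h (\<kappa> p)) \<in> borel_measurable M"
    by (rule measurable_compose[rotated])
  then show ?thesis by (simp add: h)
qed

text \<open>A nondecreasing \<phi> is Borel, and \<open>u\<close> is 1-Lipschitz as a function of
  \<phi>; hence \<open>u\<close> is Borel and bounded on the interval.\<close>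

lemma controls_integrable:
  fixes u :: "real \<Rightarrow> complex"
  assumes "controls a b \<phi> u"
  shows "(\<lambda>t. osc k t * u t) integrable_on {a..b}"
proof (cases "a \<le> b")
  case True
  \<comment> \<open>Clamping to \<open>{a..b}\<close> extends \<phi> and \<open>u\<close> to the
    whole line while keeping the monotonicity of \<phi> and the bound on \<open>u\<close>.\<close>
  define cl where "cl t = max a (min b t)" for t
  have cl: "a \<le> cl t" "cl t \<le> b" for t using True by (auto simp: cl_def)
  have clm: "s \<le> t \<Longrightarrow> cl s \<le> cl t" for s t by (auto simp: cl_def)
  have ctr: "norm (u (cl t) - u (cl s)) \<le> \<phi> (cl t) - \<phi> (cl s)" if "s \<le> t" for s t
    by (rule controlsD[OF assms]) (use cl clm that in auto)
  have "mono (\<lambda>t. \<phi> (cl t))"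
    using ctr by (intro monoI) (metis diff_ge_0_iff_ge norm_ge_zero order_trans)
  then have "(\<lambda>t. \<phi> (cl t)) \<in> borel_measurable lborel"
    by (simp add: borel_measurable_mono)
  then have meas: "(\<lambda>t. u (cl t)) \<in> borel_measurable lborel"
  proof (rule borel_measurable_Lipschitz_factor[where C = 1])
    fix s t
    have "dist (u (cl s)) (u (cl t)) \<le> dist (\<phi> (cl s)) (\<phi> (cl t))"
    proof (cases "s \<le> t")
      case True
      then have "dist (u (cl t)) (u (cl s)) \<le> dist (\<phi> (cl t)) (\<phi> (cl s))"
        unfolding dist_norm real_norm_def using ctr[of s t] by linarith
      then show ?thesis by (simp only: dist_commute)
    next
      case False
      then show ?thesis
        unfolding dist_norm real_norm_def using ctr[of t s] by linarith
    qed
    then show "dist (u (cl s)) (u (cl t)) \<le> 1 * dist (\<phi> (cl s)) (\<phi> (cl t))" by simp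
  qed
  have bd: "norm (u (cl t)) \<le> norm (u a) + (\<phi> b - \<phi> a)" for t
    using controlsD[OF assms, of a "cl t"] controlsD[OF assms, of "cl t" b] cl[of t]
      norm_triangle_sub[of "u (cl t)" "u a"] norm_ge_zero[of "u b - u (cl t)"] by linarith
  have "set_integrable lborel {a..b} (\<lambda>t. osc k t * u (cl t))"
    unfolding set_integrable_def
  proof (rule integrableI_bounded_set_indicator)
    show "(\<lambda>t. osc k t * u (cl t)) \<in> borel_measurable lborel"
      using meas borel_measurable_continuous_onI[OF continuous_on_osc, of k]
      by (intro borel_measurable_times) simp_all
    show "AE t in lborel. t \<in> {a..b} \<longrightarrow>
        norm (osc k t * u (cl t)) \<le> norm (u a) + (\<phi> b - \<phi> a)"
      using bd by (simp add: norm_mult)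
    show "emeasure lborel {a..b} < \<infinity>"
      using True by (simp add: less_top)
  qed simp
  then have int: "(\<lambda>t. osc k t * u (cl t)) integrable_on {a..b}"
    by (rule set_borel_integral_eq_integral(1))
  have "cl t = t" if "t \<in> {a..b}" for t
    using that unfolding cl_def atLeastAtMost_iff by linarith
  then show ?thesis
    by (intro integrable_eq[OF int]) (simp only:)
next
  case False
  then show ?thesis by (simp add: integrable_on_empty)
qed

section \<open>The Stieltjes integral of \<open>osc k\<close> on an interval\<close>

text \<open>This is the integral of \<open>osc k\<close> with respect to \<open>du\<close>, written
  through integration by parts. The plus sign before the last term arises because the derivative of
  \<open>osc k\<close> is \<open>- \<i> * k * osc k\<close>.\<close>

definition stj :: "real \<Rightarrow> real \<Rightarrow> real \<Rightarrow> (real \<Rightarrow> complex) \<Rightarrow> complex" where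
  "stj k a b u = osc k b * u b - osc k a * u a + \<i> * k * integral {a..b} (\<lambda>t. osc k t * u t)"

lemma stj_add:
  assumes "(\<lambda>t. osc k t * u t) integrable_on {a..b}" "(\<lambda>t. osc k t * v t) integrable_on {a..b}"
  shows "stj k a b (\<lambda>t. u t + v t) = stj k a b u + stj k a b v"
  unfolding stj_def distrib_left integral_add[OF assms] by (simp only: algebra_simps)

lemma stj_diff:
  assumes "(\<lambda>t. osc k t * u t) integrable_on {a..b}" "(\<lambda>t. osc k t * v t) integrable_on {a..b}"
  shows "stj k a b (\<lambda>t. u t - v t) = stj k a b u - stj k a b v"
  unfolding stj_def right_diff_distrib integral_diff[OF assms] by (simp only: algebra_simps)

lemma stj_combine:
  assumes "(\<lambda>t. osc k t * u t) integrable_on {a..c}" "a \<le> b" "b \<le> c"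
  shows "stj k a b u + stj k b c u = stj k a c u"
  unfolding stj_def Henstock_Kurzweil_Integration.integral_combine[OF assms(2,3,1), symmetric]
  by (simp only: algebra_simps)

lemma stj_refl [simp]: "stj k a a u = 0"
  by (simp add: stj_def)

text \<open>The term \<open>(osc k b - osc k a) * u b\<close> is itself an integral of the
  derivative of \<open>osc k\<close>. Absorbing it turns the error into one integral of
  \<open>- \<i> * k * osc k t * (u b - u t)\<close>, and \<open>u b - u t\<close> is at most
  \<open>\<phi> b - \<phi> a\<close> in norm.\<close>

lemma stj_approx:
  assumes u: "controls a b \<phi> u" and ab: "a \<le> b"
  shows "norm (stj k a b u - osc k a * (u b - u a)) \<le> \<bar>k\<bar> * (b - a) * (\<phi> b - \<phi> a)"
proof -
  have I1: "((\<lambda>t. \<i> * k * (osc k t * u t)) has_integral \<i> * k * integral {a..b} (\<lambda>t. osc k t * u t)) {a..b}"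
    by (intro has_integral_mult_right integrable_integral controls_integrable[OF u])
  have I2: "((\<lambda>t. - \<i> * k * osc k t * u b) has_integral (osc k b - osc k a) * u b) {a..b}"
    by (intro has_integral_mult_left osc_integral ab)
  have "\<i> * k * integral {a..b} (\<lambda>t. osc k t * u t) + (osc k b - osc k a) * u b
      = stj k a b u - osc k a * (u b - u a)"
    unfolding stj_def by algebra
  moreover have "\<i> * k * (osc k t * u t) + - \<i> * k * osc k t * u b = - \<i> * k * osc k t * (u b - u t)" for t
    by algebra
  ultimately have *: "((\<lambda>t. - \<i> * k * osc k t * (u b - u t)) has_integral
      (stj k a b u - osc k a * (u b - u a))) {a..b}"
    using has_integral_add[OF I1 I2] by (simp only:)
  have "norm (- \<i> * k * osc k t * (u b - u t)) \<le> \<bar>k\<bar> * (\<phi> b - \<phi> a)" if "t \<in> {a..b}" for t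
  proof -
    have "norm (u b - u t) \<le> \<phi> b - \<phi> a"
      using controlsD[OF u, of t b] controlsD[OF u, of a t] that norm_ge_zero[of "u t - u a"]
      unfolding atLeastAtMost_iff by linarith
    then have "\<bar>k\<bar> * norm (u b - u t) \<le> \<bar>k\<bar> * (\<phi> b - \<phi> a)"
      by (intro mult_left_mono) auto
    then show ?thesis by (simp only: norm_mult norm_minus_cancel norm_osc norm_of_real norm_ii)
  qed
  moreover have "0 \<le> \<phi> b - \<phi> a"
    using controlsD[OF u, of a b] ab norm_ge_zero[of "u b - u a"] by linarith
  ultimately show ?thesis
    using norm_has_integral_le[OF * ab, of "\<bar>k\<bar> * (\<phi> b - \<phi> a)"]
    by (simp add: ac_simps)
qed

lemma stj_crude:
  assumes "controls a b \<phi> u" "a \<le> b"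
  shows "norm (stj k a b u) \<le> (1 + \<bar>k\<bar> * (b - a)) * (\<phi> b - \<phi> a)"
proof -
  have "norm (stj k a b u) \<le> norm (osc k a * (u b - u a)) + norm (stj k a b u - osc k a * (u b - u a))"
    by (rule norm_triangle_sub)
  also have "\<dots> \<le> (\<phi> b - \<phi> a) + \<bar>k\<bar> * (b - a) * (\<phi> b - \<phi> a)"
    using stj_approx[OF assms] controlsD[OF assms(1), of a b] assms(2)
    by (intro add_mono) (auto simp: norm_mult)
  finally show ?thesis by (simp only: algebra_simps)
qed

text \<open>Additivity over finer and finer equidistant grids removes the error term of the crude bound.\<close>

lemma norm_stj_le:
  assumes u: "controls a b \<phi> u" and ab: "a \<le> b"
  shows "norm (stj k a b u) \<le> \<phi> b - \<phi> a"
proof -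
  have "norm (stj k a b u) \<le> (1 + \<bar>k\<bar> * ((b - a) / real (Suc n))) * (\<phi> b - \<phi> a)" for n
  proof -
    define h where "h = (b - a) / real (Suc n)"
    define x where "x i = a + real i * h" for i
    have h: "0 \<le> h" using ab by (simp add: h_def)
    have x0: "x 0 = a" "x (Suc n) = b"
      by (simp_all add: x_def h_def del: of_nat_Suc)
    have xm: "i \<le> j \<Longrightarrow> x i \<le> x j" for i j
      using h by (simp add: x_def mult_right_mono)
    \<comment> \<open>All pieces have length \<open>h\<close>, hence the same crude factor, so the
      increments of \<phi> telescope.\<close>
    have "norm (stj k a (x m) u) \<le> (1 + \<bar>k\<bar> * h) * (\<phi> (x m) - \<phi> a)" if "m \<le> Suc n" for m
      using that
    proof (induction m)
      case 0
      then show ?case by (simp add: x0)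
    next
      case (Suc m)
      have bds: "a \<le> x m" "x m \<le> x (Suc m)" "x (Suc m) \<le> b"
        using xm[of 0 m] xm[of m "Suc m"] xm[of "Suc m" "Suc n"] Suc.prems by (auto simp: x0)
      have "norm (stj k a (x (Suc m)) u) \<le> norm (stj k a (x m) u) + norm (stj k (x m) (x (Suc m)) u)"
        using bds controls_integrable[OF controls_subinterval[OF u, of a "x (Suc m)"]]
        by (subst stj_combine[symmetric, of _ _ _ _ "x m"]) (auto intro: norm_triangle_ineq)
      also have "norm (stj k (x m) (x (Suc m)) u) \<le> (1 + \<bar>k\<bar> * h) * (\<phi> (x (Suc m)) - \<phi> (x m))"
        using stj_crude[OF controls_subinterval[OF u], of "x m" "x (Suc m)" k] bds
        by (simp add: x_def algebra_simps)
      finally show ?case using Suc by (simp add: algebra_simps)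
    qed
    from this[of "Suc n"] show ?thesis by (simp add: x0 h_def)
  qed
  moreover have "(\<lambda>n. (1 + \<bar>k\<bar> * ((b - a) / real (Suc n))) * (\<phi> b - \<phi> a))
      \<longlonglongrightarrow> (1 + \<bar>k\<bar> * 0) * (\<phi> b - \<phi> a)"
    by (intro tendsto_intros LIMSEQ_Suc[OF lim_const_over_n])
  ultimately show ?thesis
    using LIMSEQ_le_const by fastforce
qed

section \<open>The Stieltjes integral over rectangles\<close>

text \<open>This is the value of \<open>\<integral>\<integral> osc \<xi> x * osc \<eta> y df(x, y)\<close> after integrating by
  parts first in \<open>y\<close> and then in \<open>x\<close>.\<close>

definition stj_inner where
  "stj_inner \<eta> f c d x = stj \<eta> c d (\<lambda>s. complex_of_real (f (x, s)))"

fun stj2 :: "real \<Rightarrow> real \<Rightarrow> (real \<times> real \<Rightarrow> real) \<Rightarrow> rect \<Rightarrow> complex" where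
  "stj2 \<xi> \<eta> f (a, b, c, d) = stj \<xi> a b (stj_inner \<eta> f c d)"

text \<open>The general filter covers \<open>at_top\<close> and \<open>at_bot\<close> together; the
  norm of a pair dominates that of either coordinate.\<close>

lemma filterlim_Pair_at_infinity:
  assumes "F \<le> at_infinity"
  shows "filterlim (\<lambda>x::real. (x, y::real)) at_infinity F"
    and "filterlim (\<lambda>x::real. (y::real, x)) at_infinity F"
proof -
  have F: "filterlim (\<lambda>x::real. norm x) at_top F"
    by (rule filterlim_mono[OF filterlim_at_infinity_imp_norm_at_top[OF filterlim_ident] order_refl assms])
  show "filterlim (\<lambda>x::real. (x, y::real)) at_infinity F"
    by (rule filterlim_norm_at_top_imp_at_infinity, rule filterlim_at_top_mono[OF F],
        intro always_eventually allI norm_fst_le)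
  show "filterlim (\<lambda>x::real. (y::real, x)) at_infinity F"
    by (rule filterlim_norm_at_top_imp_at_infinity, rule filterlim_at_top_mono[OF F],
        intro always_eventually allI norm_snd_le)
qed

text \<open>Superadditivity converts a bound by the strip over \<open>{s<..t}\<close> into a
  difference of values of one function of the endpoint, as \<open>controls\<close> demands.\<close>

lemma controls_varmI:
  assumes "f \<in> BV_V"
    and "\<And>s t. a \<le> s \<Longrightarrow> s \<le> t \<Longrightarrow> t \<le> b \<Longrightarrow> norm (u t - u s) \<le> varm f ({s<..t} \<times> Y)"
  shows "controls a b (\<lambda>s. varm f ({a<..s} \<times> Y)) u"
proof (rule controlsI)
  fix s t assume st: "a \<le> s" "s \<le> t" "t \<le> b"
  have "varm f ({a<..s} \<times> Y) + varm f ({s<..t} \<times> Y) \<le> varm f ({a<..t} \<times> Y)"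
    using st by (intro varm_superadd_le[OF assms(1)]) auto
  then show "norm (u t - u s) \<le> varm f ({a<..t} \<times> Y) - varm f ({a<..s} \<times> Y)"
    using assms(2)[OF st] by linarith
qed

lemma controls_varmI':
  assumes "f \<in> BV_V"
    and "\<And>s t. a \<le> s \<Longrightarrow> s \<le> t \<Longrightarrow> t \<le> b \<Longrightarrow> norm (u t - u s) \<le> varm f (X \<times> {s<..t})"
  shows "controls a b (\<lambda>s. varm f (X \<times> {a<..s})) u"
proof (rule controlsI)
  fix s t assume st: "a \<le> s" "s \<le> t" "t \<le> b"
  have "varm f (X \<times> {a<..s}) + varm f (X \<times> {s<..t}) \<le> varm f (X \<times> {a<..t})"
    using st by (intro varm_superadd_le[OF assms(1)]) auto
  then show "norm (u t - u s) \<le> varm f (X \<times> {a<..t}) - varm f (X \<times> {a<..s})"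
    using assms(2)[OF st] by linarith
qed

lemma grid_mono:
  fixes x :: "nat \<Rightarrow> real"
  assumes "\<forall>i<n. x i < x (Suc i)" "i \<le> j" "j \<le> n"
  shows "x i \<le> x j"
  using assms(2,3)
proof (induction j rule: dec_induct)
  case (step m)
  then show ?case using assms(1)[rule_format, of m] by simp
qed simp

lemma grid_cells_disjoint:
  fixes x y :: "nat \<Rightarrow> real"
  assumes x: "\<forall>i<n. x i < x (Suc i)" and y: "\<forall>j<m. y j < y (Suc j)"
  shows "disjoint_family_on (\<lambda>(i, j). {x i<..x (Suc i)} \<times> {y j<..y (Suc j)}) ({..<n} \<times> {..<m})"
proof -
  have X: "{x i<..x (Suc i)} \<inter> {x j<..x (Suc j)} = {}" if "i < n" "j < n" "i \<noteq> j" for i j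
    using grid_mono[OF x, of "Suc i" j] grid_mono[OF x, of "Suc j" i] that
    by (cases "i < j") (force simp: not_less)+
  have Y: "{y i<..y (Suc i)} \<inter> {y j<..y (Suc j)} = {}" if "i < m" "j < m" "i \<noteq> j" for i j
    using grid_mono[OF y, of "Suc i" j] grid_mono[OF y, of "Suc j" i] that
    by (cases "i < j") (force simp: not_less)+
  show ?thesis
    unfolding disjoint_family_on_def
  proof (intro ballI impI)
    fix p q assume pq: "p \<in> {..<n} \<times> {..<m}" "q \<in> {..<n} \<times> {..<m}" "p \<noteq> q"
    obtain i j where p: "p = (i, j)" by (cases p) auto
    obtain k l where q: "q = (k, l)" by (cases q) auto
    have "i \<noteq> k \<or> j \<noteq> l" using pq(3) p q by auto
    then show "(case p of (i, j) \<Rightarrow> {x i<..x (Suc i)} \<times> {y j<..y (Suc j)}) \<inter>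
        (case q of (i, j) \<Rightarrow> {x i<..x (Suc i)} \<times> {y j<..y (Suc j)}) = {}"
      using X[of i k] Y[of j l] pq(1,2) unfolding p q by (auto simp: Times_Int_Times)
  qed
qed

lemma fourier_kernel_eq: "fourier_kernel \<xi> \<eta> (x, y) = osc \<xi> x * osc \<eta> y"
  by (simp add: fourier_kernel_def osc_def exp_add[symmetric] distrib_left)

section \<open>Increments of f along lines\<close>

context
  fixes f :: "real \<times> real \<Rightarrow> real"
  assumes f0: "f \<in> BV_0"
begin

lemma bv: "f \<in> BV_V"
  using f0 by (simp add: BV_0_def)

lemma lines_vanish:
  assumes "F \<le> at_infinity"
  shows "((\<lambda>x. f (x, y)) \<longlongrightarrow> 0) F" "((\<lambda>x. f (y, x)) \<longlongrightarrow> 0) F"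
  using f0 filterlim_Pair_at_infinity[OF assms] unfolding BV_0_def
  by (auto intro: filterlim_compose)

text \<open>The segment is one side of a rectangle whose opposite side is pushed to infinity, where
  f vanishes; the planar increment then tends to the increment along the segment up to sign. Pushing
  right or left gives two half-strips, so that later one can be chosen that avoids a central
  square.\<close>

lemma line_increment_y:
  assumes st: "s \<le> t"
  shows "\<bar>f (x, t) - f (x, s)\<bar> \<le> varm f ({x<..} \<times> {s<..t})"
    and "\<bar>f (x, t) - f (x, s)\<bar> \<le> varm f ({..x} \<times> {s<..t})"
proof -
  have "((\<lambda>x'. \<bar>f (x', t) - f (x, t) - f (x', s) + f (x, s)\<bar>)
      \<longlongrightarrow> \<bar>0 - f (x, t) - 0 + f (x, s)\<bar>) at_top"
    by (intro tendsto_intros lines_vanish at_top_le_at_infinity at_bot_le_at_infinity)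
  moreover have "\<forall>\<^sub>F x' in at_top. \<bar>f (x', t) - f (x, t) - f (x', s) + f (x, s)\<bar>
      \<le> varm f ({x<..} \<times> {s<..t})"
    using eventually_ge_at_top[of x]
  proof eventually_elim
    case (elim x')
    have "varm f ({x<..x'} \<times> {s<..t}) \<le> varm f ({x<..} \<times> {s<..t})"
      by (intro varm_mono[OF bv]) auto
    then show ?case
      using rinc_le_varm[OF bv elim st] by simp
  qed
  ultimately have "\<bar>0 - f (x, t) - 0 + f (x, s)\<bar> \<le> varm f ({x<..} \<times> {s<..t})"
    by (rule tendsto_upperbound) simp
  then show "\<bar>f (x, t) - f (x, s)\<bar> \<le> varm f ({x<..} \<times> {s<..t})" by linarith
  have "((\<lambda>x'. \<bar>f (x, t) - f (x', t) - f (x, s) + f (x', s)\<bar>)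
      \<longlongrightarrow> \<bar>f (x, t) - 0 - f (x, s) + 0\<bar>) at_bot"
    by (intro tendsto_intros lines_vanish at_top_le_at_infinity at_bot_le_at_infinity)
  moreover have "\<forall>\<^sub>F x' in at_bot. \<bar>f (x, t) - f (x', t) - f (x, s) + f (x', s)\<bar>
      \<le> varm f ({..x} \<times> {s<..t})"
    using eventually_le_at_bot[of x]
  proof eventually_elim
    case (elim x')
    have "varm f ({x'<..x} \<times> {s<..t}) \<le> varm f ({..x} \<times> {s<..t})"
      by (intro varm_mono[OF bv]) auto
    then show ?case
      using rinc_le_varm[OF bv elim st] by simp
  qed
  ultimately have "\<bar>f (x, t) - 0 - f (x, s) + 0\<bar> \<le> varm f ({..x} \<times> {s<..t})"
    by (rule tendsto_upperbound) simp
  then show "\<bar>f (x, t) - f (x, s)\<bar> \<le> varm f ({..x} \<times> {s<..t})" by linarith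
qed

lemma line_increment_x:
  assumes st: "s \<le> t"
  shows "\<bar>f (t, y) - f (s, y)\<bar> \<le> varm f ({s<..t} \<times> {y<..})"
    and "\<bar>f (t, y) - f (s, y)\<bar> \<le> varm f ({s<..t} \<times> {..y})"
proof -
  have "((\<lambda>y'. \<bar>f (t, y') - f (s, y') - f (t, y) + f (s, y)\<bar>)
      \<longlongrightarrow> \<bar>0 - 0 - f (t, y) + f (s, y)\<bar>) at_top"
    by (intro tendsto_intros lines_vanish at_top_le_at_infinity at_bot_le_at_infinity)
  moreover have "\<forall>\<^sub>F y' in at_top. \<bar>f (t, y') - f (s, y') - f (t, y) + f (s, y)\<bar>
      \<le> varm f ({s<..t} \<times> {y<..})"
    using eventually_ge_at_top[of y]
  proof eventually_elim
    case (elim y')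
    have "varm f ({s<..t} \<times> {y<..y'}) \<le> varm f ({s<..t} \<times> {y<..})"
      by (intro varm_mono[OF bv]) auto
    then show ?case
      using rinc_le_varm[OF bv st elim] by simp
  qed
  ultimately have "\<bar>0 - 0 - f (t, y) + f (s, y)\<bar> \<le> varm f ({s<..t} \<times> {y<..})"
    by (rule tendsto_upperbound) simp
  then show "\<bar>f (t, y) - f (s, y)\<bar> \<le> varm f ({s<..t} \<times> {y<..})" by linarith
  have "((\<lambda>y'. \<bar>f (t, y) - f (s, y) - f (t, y') + f (s, y')\<bar>)
      \<longlongrightarrow> \<bar>f (t, y) - f (s, y) - 0 + 0\<bar>) at_bot"
    by (intro tendsto_intros lines_vanish at_top_le_at_infinity at_bot_le_at_infinity)
  moreover have "\<forall>\<^sub>F y' in at_bot. \<bar>f (t, y) - f (s, y) - f (t, y') + f (s, y')\<bar>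
      \<le> varm f ({s<..t} \<times> {..y})"
    using eventually_le_at_bot[of y]
  proof eventually_elim
    case (elim y')
    have "varm f ({s<..t} \<times> {y'<..y}) \<le> varm f ({s<..t} \<times> {..y})"
      by (intro varm_mono[OF bv]) auto
    then show ?case
      using rinc_le_varm[OF bv st elim] by simp
  qed
  ultimately have "\<bar>f (t, y) - f (s, y) - 0 + 0\<bar> \<le> varm f ({s<..t} \<times> {..y})"
    by (rule tendsto_upperbound) simp
  then show "\<bar>f (t, y) - f (s, y)\<bar> \<le> varm f ({s<..t} \<times> {..y})" by linarith
qed

lemma line_controls_y:
  "controls c d (\<lambda>s. varm f ({x<..} \<times> {c<..s})) (\<lambda>s. complex_of_real (f (x, s)))"
  "controls c d (\<lambda>s. varm f ({..x} \<times> {c<..s})) (\<lambda>s. complex_of_real (f (x, s)))"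
  using line_increment_y
  by (auto intro!: controls_varmI'[OF bv] simp flip: of_real_diff)

lemma line_controls_x:
  "controls a b (\<lambda>s. varm f ({a<..s} \<times> {y<..})) (\<lambda>s. complex_of_real (f (s, y)))"
  "controls a b (\<lambda>s. varm f ({a<..s} \<times> {..y})) (\<lambda>s. complex_of_real (f (s, y)))"
  using line_increment_x
  by (auto intro!: controls_varmI[OF bv] simp flip: of_real_diff)

section \<open>Bounds and additivity for the double integral\<close>

text \<open>By linearity the difference is \<open>stj\<close> of the function
  \<open>f (x', s) - f (x, s)\<close> of s. Its increments are planar increments of f, so it is
  controlled by \<open>varm\<close> of rectangles of width \<open>x' - x\<close>.\<close>

lemma stj_inner_increment:
  assumes x: "x \<le> x'" and cd: "c \<le> d"
  shows "norm (stj_inner \<eta> f c d x' - stj_inner \<eta> f c d x) \<le> varm f ({x<..x'} \<times> {c<..d})"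
    and "norm (stj_inner \<eta> f c d x' - stj_inner \<eta> f c d x - osc \<eta> c * rinc f (x, x', c, d))
      \<le> \<bar>\<eta>\<bar> * (d - c) * varm f ({x<..x'} \<times> {c<..d})"
proof -
  define u where "u s = complex_of_real (f (x', s)) - complex_of_real (f (x, s))" for s
  have eq: "stj_inner \<eta> f c d x' - stj_inner \<eta> f c d x = stj \<eta> c d u"
    unfolding stj_inner_def u_def
    by (intro stj_diff[symmetric] controls_integrable[OF line_controls_y(1)])
  have u: "u t - u s = complex_of_real (rinc f (x, x', s, t))" for s t
    by (simp add: u_def)
  have ctr: "controls c d (\<lambda>s. varm f ({x<..x'} \<times> {c<..s})) u"
    by (rule controls_varmI'[OF bv]) (simp only: u norm_of_real rinc_le_varm[OF bv x])
  show "norm (stj_inner \<eta> f c d x' - stj_inner \<eta> f c d x) \<le> varm f ({x<..x'} \<times> {c<..d})"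
    using norm_stj_le[OF ctr cd, of \<eta>] by (simp add: eq varm_empty[OF bv])
  show "norm (stj_inner \<eta> f c d x' - stj_inner \<eta> f c d x - osc \<eta> c * rinc f (x, x', c, d))
      \<le> \<bar>\<eta>\<bar> * (d - c) * varm f ({x<..x'} \<times> {c<..d})"
    using stj_approx[OF ctr cd, of \<eta>] unfolding eq u by (simp add: varm_empty[OF bv])
qed

lemma stj_inner_controls:
  assumes "c \<le> d"
  shows "controls a b (\<lambda>x. varm f ({a<..x} \<times> {c<..d})) (stj_inner \<eta> f c d)"
  by (rule controls_varmI[OF bv]) (rule stj_inner_increment(1)[OF _ assms])

lemma norm_stj2_le:
  assumes "a \<le> b" "c \<le> d"
  shows "norm (stj2 \<xi> \<eta> f (a, b, c, d)) \<le> varm f ({a<..b} \<times> {c<..d})"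
  using norm_stj_le[OF stj_inner_controls[OF assms(2)] assms(1)]
  by (simp add: varm_empty[OF bv])

lemma stj2_combine_x:
  assumes "a \<le> b" "b \<le> b'" "c \<le> d"
  shows "stj2 \<xi> \<eta> f (a, b, c, d) + stj2 \<xi> \<eta> f (b, b', c, d) = stj2 \<xi> \<eta> f (a, b', c, d)"
  using stj_combine[OF controls_integrable[OF stj_inner_controls] assms(1,2)] assms(3) by simp

text \<open>In this variable the splitting happens pointwise in the inner integral, and linearity of
  the outer \<open>stj\<close> carries it over.\<close>

lemma stj2_combine_y:
  assumes "c \<le> d" "d \<le> d'"
  shows "stj2 \<xi> \<eta> f (a, b, c, d) + stj2 \<xi> \<eta> f (a, b, d, d') = stj2 \<xi> \<eta> f (a, b, c, d')"
proof -
  have "stj_inner \<eta> f c d' = (\<lambda>x. stj_inner \<eta> f c d x + stj_inner \<eta> f d d' x)"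
    unfolding stj_inner_def
    by (intro ext stj_combine[symmetric] controls_integrable[OF line_controls_y(1)] assms)
  then show ?thesis
    using stj_add[OF controls_integrable[OF stj_inner_controls[OF assms(1)]]
        controls_integrable[OF stj_inner_controls[OF assms(2)]]] by simp
qed

text \<open>Three errors are added: moving the tag to the lower left corner costs
  \<open>\<bar>\<xi>\<bar> + \<bar>\<eta>\<bar>\<close>, freezing \<open>osc \<eta>\<close> at
  \<open>c\<close> in the inner integral costs \<open>\<bar>\<eta>\<bar>\<close>, and freezing
  \<open>osc \<xi>\<close> at \<open>a\<close> in the outer one costs
  \<open>\<bar>\<xi>\<bar>\<close>, each times \<delta> and the variation on the cell.\<close>

lemma stj2_cell:
  assumes ab: "a \<le> b" and cd: "c \<le> d" and p: "p \<in> {a..b} \<times> {c..d}"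
    and \<delta>: "b - a \<le> \<delta>" "d - c \<le> \<delta>"
  shows "norm (fourier_kernel \<xi> \<eta> p * rinc f (a, b, c, d) - stj2 \<xi> \<eta> f (a, b, c, d))
    \<le> 2 * (\<bar>\<xi>\<bar> + \<bar>\<eta>\<bar>) * \<delta> * varm f ({a<..b} \<times> {c<..d})"
proof -
  define v where "v = varm f ({a<..b} \<times> {c<..d})"
  define r where "r = complex_of_real (rinc f (a, b, c, d))"
  define I where "I = stj_inner \<eta> f c d"
  have v: "0 \<le> v" unfolding v_def by (rule varm_nonneg[OF bv])
  obtain s t where st: "p = (s, t)" "a \<le> s" "s \<le> b" "c \<le> t" "t \<le> d"
    using p by auto
  have "norm (fourier_kernel \<xi> \<eta> p - osc \<xi> a * osc \<eta> c)
      = norm ((osc \<xi> s - osc \<xi> a) * osc \<eta> t + osc \<xi> a * (osc \<eta> t - osc \<eta> c))"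
    by (simp add: st fourier_kernel_eq algebra_simps)
  also have "\<dots> \<le> norm ((osc \<xi> s - osc \<xi> a) * osc \<eta> t) + norm (osc \<xi> a * (osc \<eta> t - osc \<eta> c))"
    by (rule norm_triangle_ineq)
  also have "\<dots> \<le> \<bar>\<xi>\<bar> * \<bar>s - a\<bar> + \<bar>\<eta>\<bar> * \<bar>t - c\<bar>"
    unfolding norm_mult norm_osc using osc_Lipschitz[of \<xi> s a] osc_Lipschitz[of \<eta> t c] by simp
  also have "\<dots> \<le> \<bar>\<xi>\<bar> * \<delta> + \<bar>\<eta>\<bar> * \<delta>"
    using st \<delta> by (intro add_mono mult_left_mono) auto
  finally have "norm (fourier_kernel \<xi> \<eta> p - osc \<xi> a * osc \<eta> c) \<le> \<bar>\<xi>\<bar> * \<delta> + \<bar>\<eta>\<bar> * \<delta>" .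
  moreover have "norm r \<le> v"
    using rinc_le_varm[OF bv ab cd] by (simp only: r_def v_def norm_of_real)
  ultimately have 1: "norm ((fourier_kernel \<xi> \<eta> p - osc \<xi> a * osc \<eta> c) * r) \<le> (\<bar>\<xi>\<bar> * \<delta> + \<bar>\<eta>\<bar> * \<delta>) * v"
    unfolding norm_mult using \<delta> ab by (intro mult_mono) auto
  have "norm (I b - I a - osc \<eta> c * r) \<le> \<bar>\<eta>\<bar> * (d - c) * v"
    unfolding I_def r_def v_def by (rule stj_inner_increment(2)[OF ab cd])
  also have "\<dots> \<le> \<bar>\<eta>\<bar> * \<delta> * v"
    using \<delta> v by (intro mult_right_mono mult_left_mono) auto
  finally have 2: "norm (osc \<xi> a * (osc \<eta> c * r - (I b - I a))) \<le> \<bar>\<eta>\<bar> * \<delta> * v"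
    by (simp add: norm_mult norm_minus_commute)
  have "norm (stj2 \<xi> \<eta> f (a, b, c, d) - osc \<xi> a * (I b - I a)) \<le> \<bar>\<xi>\<bar> * (b - a) * v"
    using stj_approx[OF stj_inner_controls[OF cd] ab, of \<xi> \<eta>]
    by (simp add: I_def v_def varm_empty[OF bv])
  also have "\<dots> \<le> \<bar>\<xi>\<bar> * \<delta> * v"
    using \<delta> v by (intro mult_right_mono mult_left_mono) auto
  finally have 3: "norm (osc \<xi> a * (I b - I a) - stj2 \<xi> \<eta> f (a, b, c, d)) \<le> \<bar>\<xi>\<bar> * \<delta> * v"
    by (simp only: norm_minus_commute)
  have "fourier_kernel \<xi> \<eta> p * r - stj2 \<xi> \<eta> f (a, b, c, d)
      = (fourier_kernel \<xi> \<eta> p - osc \<xi> a * osc \<eta> c) * r + osc \<xi> a * (osc \<eta> c * r - (I b - I a))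
        + (osc \<xi> a * (I b - I a) - stj2 \<xi> \<eta> f (a, b, c, d))"
    by (simp only: algebra_simps)
  also have "norm \<dots> \<le> (\<bar>\<xi>\<bar> * \<delta> + \<bar>\<eta>\<bar> * \<delta>) * v + \<bar>\<eta>\<bar> * \<delta> * v + \<bar>\<xi>\<bar> * \<delta> * v"
    by (rule order_trans[OF norm_triangle_ineq add_mono[OF order_trans[OF norm_triangle_ineq add_mono[OF 1 2]] 3]])
  also have "\<dots> = 2 * (\<bar>\<xi>\<bar> + \<bar>\<eta>\<bar>) * \<delta> * v"
    by (simp add: algebra_simps)
  finally show ?thesis by (simp only: r_def v_def)
qed

lemma stj2_grid:
  assumes P: "(n, x, m, y) \<in> partitions (a, b, c, d)"
  shows "stj2 \<xi> \<eta> f (a, b, c, d)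
    = (\<Sum>i<n. \<Sum>j<m. stj2 \<xi> \<eta> f (x i, x (Suc i), y j, y (Suc j)))"
proof -
  have x: "x 0 = a" "x n = b" "\<forall>i<n. x i < x (Suc i)"
    and y: "y 0 = c" "y m = d" "\<forall>j<m. y j < y (Suc j)"
    using P by auto
  have Y: "stj2 \<xi> \<eta> f (s, t, y 0, y k) = (\<Sum>j<k. stj2 \<xi> \<eta> f (s, t, y j, y (Suc j)))"
    if "k \<le> m" for s t k
    using that
  proof (induction k)
    case 0
    then show ?case by (simp add: stj_inner_def stj_def)
  next
    case (Suc k)
    then show ?case
      using stj2_combine_y[of "y 0" "y k" "y (Suc k)" \<xi> \<eta> s t] grid_mono[OF y(3)]
      by (simp del: stj2.simps)
  qed
  have cd: "c \<le> d" using grid_mono[OF y(3), of 0 m] y by simp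
  have X: "stj2 \<xi> \<eta> f (x 0, x k, c, d) = (\<Sum>i<k. stj2 \<xi> \<eta> f (x i, x (Suc i), c, d))"
    if "k \<le> n" for k
    using that
  proof (induction k)
    case 0
    then show ?case by simp
  next
    case (Suc k)
    then show ?case
      using stj2_combine_x[of "x 0" "x k" "x (Suc k)" c d \<xi> \<eta>] grid_mono[OF x(3)] cd
      by (simp del: stj2.simps)
  qed
  show ?thesis
    using X[of n] Y[of m] x y by (simp del: stj2.simps)
qed

section \<open>Convergence of the Riemann-Stieltjes sums\<close>

lemma RS_sum_close:
  assumes P: "(n, x, m, y) \<in> partitions (a, b, c, d)" and t: "t \<in> tags (n, x, m, y)"
  shows "norm ((\<Sum>i<n. \<Sum>j<m. fourier_kernel \<xi> \<eta> (t i j) * incr f x y i j) - stj2 \<xi> \<eta> f (a, b, c, d))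
    \<le> 2 * (\<bar>\<xi>\<bar> + \<bar>\<eta>\<bar>) * \<bar>mesh (n, x, m, y)\<bar> * varm f UNIV"
proof -
  let ?Q = "\<lambda>i j. (x i, x (Suc i), y j, y (Suc j))"
  let ?H = "\<lambda>i j. {x i<..x (Suc i)} \<times> {y j<..y (Suc j)}"
  \<comment> \<open>A degenerate rectangle admits a grid without cells, whose \<open>mesh\<close> is
    an unspecified \<open>Max {}\<close>; the absolute value keeps \<open>K\<close> nonnegative
    there.\<close>
  define K where "K = 2 * (\<bar>\<xi>\<bar> + \<bar>\<eta>\<bar>) * \<bar>mesh (n, x, m, y)\<bar>"
  have K: "0 \<le> K" by (simp add: K_def)
  have x: "\<forall>i<n. x i < x (Suc i)" and y: "\<forall>j<m. y j < y (Suc j)"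
    using P by auto
  have cell: "norm (fourier_kernel \<xi> \<eta> (t i j) * incr f x y i j - stj2 \<xi> \<eta> f (?Q i j)) \<le> K * varm f (?H i j)"
    if ij: "i < n" "j < m" for i j
  proof -
    have "dist (x i, y j) (x (Suc i), y (Suc j)) \<le> mesh (n, x, m, y)"
      using ij by (force intro!: Max_ge)
    moreover have "dist (x i) (x (Suc i)) \<le> dist (x i, y j) (x (Suc i), y (Suc j))"
      "dist (y j) (y (Suc j)) \<le> dist (x i, y j) (x (Suc i), y (Suc j))"
      using dist_fst_le[of "(x i, y j)" "(x (Suc i), y (Suc j))"]
        dist_snd_le[of "(x i, y j)" "(x (Suc i), y (Suc j))"] by simp_all
    ultimately have \<delta>: "x (Suc i) - x i \<le> \<bar>mesh (n, x, m, y)\<bar>" "y (Suc j) - y j \<le> \<bar>mesh (n, x, m, y)\<bar>"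
      unfolding dist_real_def by linarith+
    have "incr f x y i j = rinc f (?Q i j)"
      by (simp add: incr_def)
    moreover have "t i j \<in> {x i..x (Suc i)} \<times> {y j..y (Suc j)}" using t ij by simp
    ultimately show ?thesis
      unfolding K_def using stj2_cell[OF _ _ _ \<delta>, of "t i j"] x y ij
      by (simp only: less_imp_le)
  qed
  have "norm ((\<Sum>i<n. \<Sum>j<m. fourier_kernel \<xi> \<eta> (t i j) * incr f x y i j) - stj2 \<xi> \<eta> f (a, b, c, d))
      = norm (\<Sum>i<n. \<Sum>j<m. fourier_kernel \<xi> \<eta> (t i j) * incr f x y i j - stj2 \<xi> \<eta> f (?Q i j))"
    unfolding stj2_grid[OF P] sum_subtractf ..
  also have "\<dots> \<le> (\<Sum>i<n. \<Sum>j<m. K * varm f (?H i j))"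
    using cell by (intro sum_norm_le) auto
  also have "\<dots> = K * (\<Sum>(i, j)\<in>{..<n} \<times> {..<m}. varm f (?H i j))"
    by (simp add: sum_distrib_left sum.cartesian_product case_prod_unfold)
  also have "(\<Sum>(i, j)\<in>{..<n} \<times> {..<m}. varm f (?H i j)) \<le> varm f UNIV"
    using varm_sum_le[OF bv _ grid_cells_disjoint[OF x y]] varm_mono[OF bv subset_UNIV]
    by (simp add: case_prod_unfold) (meson order_trans)
  finally show ?thesis
    using K by (simp add: K_def mult_left_mono)
qed

lemma RS_sum_Re_Im:
  "RS_sum (\<lambda>z. Re (g z)) f (n, x, m, y) t = Re (\<Sum>i<n. \<Sum>j<m. g (t i j) * incr f x y i j)"
  "RS_sum (\<lambda>z. Im (g z)) f (n, x, m, y) t = Im (\<Sum>i<n. \<Sum>j<m. g (t i j) * incr f x y i j)"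
  by simp_all

lemma mesh_nonneg:
  assumes "P \<in> partitions R" "R \<in> rects"
  shows "0 \<le> mesh P"
proof -
  obtain n x m y where P: "P = (n, x, m, y)" by (cases P)
  have "0 < n" "0 < m"
    using assms by (auto simp: P rects_def intro!: Nat.gr0I)
  then have "dist (x 0, y 0) (x (Suc 0), y (Suc 0)) \<le> mesh P"
    unfolding P by (force intro!: Max_ge)
  then show ?thesis using zero_le_dist order_trans by blast
qed

lemma has_RS_integral_stj2:
  assumes "R \<in> rects"
  shows "has_RS_integral (fourier_kernel \<xi> \<eta>) f R (stj2 \<xi> \<eta> f R)"
proof -
  \<comment> \<open>The summand 1 keeps \<open>K\<close> positive when the variation is zero, so
    that \<open>\<epsilon> / K\<close> can serve as the mesh bound.\<close>
  define K where "K = 2 * (\<bar>\<xi>\<bar> + \<bar>\<eta>\<bar>) * varm f UNIV + 1"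
  have K: "0 < K" unfolding K_def using varm_nonneg[OF bv] by (simp add: add_nonneg_pos)
  obtain a b c d where R: "R = (a, b, c, d)" by (cases R)
  have close: "\<bar>RS_sum (\<lambda>z. Re (fourier_kernel \<xi> \<eta> z)) f P t - Re (stj2 \<xi> \<eta> f R)\<bar> < \<epsilon>"
      "\<bar>RS_sum (\<lambda>z. Im (fourier_kernel \<xi> \<eta> z)) f P t - Im (stj2 \<xi> \<eta> f R)\<bar> < \<epsilon>"
    if "P \<in> partitions R" "mesh P < \<epsilon> / K" "t \<in> tags P" for \<epsilon> P t
  proof -
    obtain n x m y where P: "P = (n, x, m, y)" by (cases P)
    define S where "S = (\<Sum>i<n. \<Sum>j<m. fourier_kernel \<xi> \<eta> (t i j) * incr f x y i j)"
    have pos: "0 \<le> mesh P" by (rule mesh_nonneg[OF that(1) assms])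
    have "norm (S - stj2 \<xi> \<eta> f R) \<le> 2 * (\<bar>\<xi>\<bar> + \<bar>\<eta>\<bar>) * \<bar>mesh P\<bar> * varm f UNIV"
      unfolding S_def R P using that by (intro RS_sum_close) (simp_all only: P R)
    also have "\<dots> \<le> K * mesh P"
      using pos by (simp add: K_def algebra_simps)
    also have "\<dots> < \<epsilon>"
      using that(2) K by (simp add: pos_less_divide_eq mult.commute)
    finally have "norm (S - stj2 \<xi> \<eta> f R) < \<epsilon>" .
    then have "\<bar>Re S - Re (stj2 \<xi> \<eta> f R)\<bar> < \<epsilon>" "\<bar>Im S - Im (stj2 \<xi> \<eta> f R)\<bar> < \<epsilon>"
      using abs_Re_le_cmod[of "S - stj2 \<xi> \<eta> f R"] abs_Im_le_cmod[of "S - stj2 \<xi> \<eta> f R"] by auto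
    then show "\<bar>RS_sum (\<lambda>z. Re (fourier_kernel \<xi> \<eta> z)) f P t - Re (stj2 \<xi> \<eta> f R)\<bar> < \<epsilon>"
      "\<bar>RS_sum (\<lambda>z. Im (fourier_kernel \<xi> \<eta> z)) f P t - Im (stj2 \<xi> \<eta> f R)\<bar> < \<epsilon>"
      by (simp_all only: P RS_sum_Re_Im S_def)
  qed
  show ?thesis
    unfolding has_RS_integral_def has_RS_integral_real_def
    using close K by (metis divide_pos_pos)
qed

end

section \<open>Fine grids and uniqueness of the integral\<close>

text \<open>Without arbitrarily fine tagged grids the defining condition of the integral would hold
  vacuously for every value; their existence makes the \<open>THE\<close> in
  \<open>RS_integral\<close> meaningful.\<close>

lemma fine_partition_exists:
  assumes "R \<in> rects" "0 < \<delta>"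
  obtains P t where "P \<in> partitions R" "mesh P < \<delta>" "t \<in> tags P"
proof -
  obtain a b c d where R: "R = (a, b, c, d)" by (cases R)
  have lt: "a < b" "c < d" using assms(1) by (auto simp: R rects_def)
  \<comment> \<open>The diagonal of a cell is at most the sum of its sides, which is
    \<open>(b - a + (d - c)) / n\<close>.\<close>
  obtain n where n: "(b - a + (d - c)) / \<delta> < real n"
    using reals_Archimedean2 by blast
  have npos: "0 < n"
    using n lt assms(2) by (intro Nat.gr0I) (auto simp: field_simps)
  define x where "x i = a + real i * ((b - a) / n)" for i
  define y where "y i = c + real i * ((d - c) / n)" for i
  have step: "x (Suc i) = x i + (b - a) / n" "y (Suc i) = y i + (d - c) / n" for i
    by (simp_all add: x_def y_def distrib_right add_divide_distrib)
  have "(n, x, n, y) \<in> partitions R"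
    using npos lt by (simp add: R step) (simp add: x_def y_def)
  moreover have "dist (x i, y j) (x (Suc i), y (Suc j)) < \<delta>" for i j
  proof -
    have "dist (x i, y j) (x (Suc i), y (Suc j)) \<le> (b - a) / n + (d - c) / n"
      using sqrt_sum_squares_le_sum_abs[of "(b - a) / n" "(d - c) / n"] lt
      by (simp add: dist_Pair_Pair step dist_real_def)
    also have "\<dots> < \<delta>"
      using n npos assms(2)
      by (simp add: add_divide_distrib[symmetric] pos_divide_less_eq mult.commute)
    finally show ?thesis .
  qed
  then have "mesh (n, x, n, y) < \<delta>"
    using npos by (subst mesh.simps, subst Max_less_iff) auto
  moreover have "(\<lambda>i j. (x i, y j)) \<in> tags (n, x, n, y)"
    using lt by (simp add: step)
  ultimately show ?thesis by (rule that)
qed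

lemma has_RS_integral_real_unique:
  assumes "has_RS_integral_real g f R A" "has_RS_integral_real g f R B" and R: "R \<in> rects"
  shows "A = B"
proof (rule ccontr)
  assume "A \<noteq> B"
  define e where "e = \<bar>A - B\<bar> / 2"
  have e: "0 < e" "\<bar>A - B\<bar> = 2 * e" using \<open>A \<noteq> B\<close> by (simp_all add: e_def)
  obtain \<delta>1 where 1: "0 < \<delta>1" "\<forall>P\<in>partitions R. mesh P < \<delta>1 \<longrightarrow>
      (\<forall>t\<in>tags P. \<bar>RS_sum g f P t - A\<bar> < e)"
    using assms(1) e(1) unfolding has_RS_integral_real_def by blast
  obtain \<delta>2 where 2: "0 < \<delta>2" "\<forall>P\<in>partitions R. mesh P < \<delta>2 \<longrightarrow>
      (\<forall>t\<in>tags P. \<bar>RS_sum g f P t - B\<bar> < e)"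
    using assms(2) e(1) unfolding has_RS_integral_real_def by blast
  obtain P t where P: "P \<in> partitions R" "mesh P < min \<delta>1 \<delta>2" "t \<in> tags P"
    using fine_partition_exists[OF R, of "min \<delta>1 \<delta>2"] 1(1) 2(1) by (metis min_less_iff_conj)
  have "\<bar>RS_sum g f P t - A\<bar> < e" "\<bar>RS_sum g f P t - B\<bar> < e"
    using 1(2) 2(2) P by auto
  moreover have "\<bar>A - B\<bar> \<le> \<bar>RS_sum g f P t - A\<bar> + \<bar>RS_sum g f P t - B\<bar>" by linarith
  ultimately show False using e(2) by linarith
qed

lemma RS_integral_eq:
  assumes "has_RS_integral g f R A" "R \<in> rects"
  shows "RS_integral g f R = A"
  unfolding RS_integral_def
proof (rule the_equality[where a = A])
  show "B = A" if "has_RS_integral g f R B" for B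
    using assms that has_RS_integral_real_unique unfolding has_RS_integral_def
    by (blast intro: complex_eqI)
qed (rule assms(1))

section \<open>Fubini's theorem and the boundary terms\<close>

lemma set_integrable_bounded:
  fixes g :: "'a::euclidean_space \<Rightarrow> complex"
  assumes "g \<in> borel_measurable borel" "\<And>p. norm (g p) \<le> B"
  shows "set_integrable lborel (cbox a b) g"
  unfolding set_integrable_def
proof (rule integrableI_bounded_set_indicator)
  show "emeasure lborel (cbox a b) < \<infinity>"
    by (simp add: emeasure_lborel_cbox_eq)
  show "AE p in lborel. p \<in> cbox a b \<longrightarrow> norm (g p) \<le> B"
    using assms(2) by simp
qed (use assms(1) in simp_all)

lemma integral_cbox_Fubini:
  fixes g :: "real \<times> real \<Rightarrow> complex"
  assumes g: "g \<in> borel_measurable borel" and bound: "\<And>p. norm (g p) \<le> B"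
  shows "g integrable_on cbox (a, c) (b, d)"
    and "(\<lambda>x. integral {c..d} (\<lambda>y. g (x, y))) integrable_on {a..b}"
    and "integral (cbox (a, c) (b, d)) g = integral {a..b} (\<lambda>x. integral {c..d} (\<lambda>y. g (x, y)))"
proof -
  have int: "set_integrable lborel (cbox (a, c) (b, d)) g"
    by (rule set_integrable_bounded[OF g bound])
  then show "g integrable_on cbox (a, c) (b, d)"
    by (rule set_borel_integral_eq_integral(1))
  \<comment> \<open>Extension by zero: Fubini for the Lebesgue integral on the whole plane then
    yields the iterated integral over the intervals.\<close>
  define h where "h p = indicator (cbox (a, c) (b, d)) p *\<^sub>R g p" for p
  have h: "integrable (lborel \<Otimes>\<^sub>M lborel) h"
    using int unfolding lborel_prod set_integrable_def h_def .
  have slice: "(LINT y|lborel. h (x, y)) = indicator {a..b} x *\<^sub>R integral {c..d} (\<lambda>y. g (x, y))" for x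
  proof -
    have "Pair x \<in> borel \<rightarrow>\<^sub>M (borel :: (real \<times> real) measure)"
      by (intro borel_measurable_continuous_onI continuous_intros)
    then have "(\<lambda>y. g (x, y)) \<in> borel_measurable borel"
      by (rule measurable_compose) (rule g)
    then have y: "set_integrable lborel {c..d} (\<lambda>y. g (x, y))"
      unfolding cbox_interval[symmetric] by (rule set_integrable_bounded) (rule bound)
    then have "(LINT y:{c..d}|lborel. g (x, y)) = integral {c..d} (\<lambda>y. g (x, y))"
      by (rule set_borel_integral_eq_integral(2))
    moreover have "h (x, y) = indicator {a..b} x *\<^sub>R (indicator {c..d} y *\<^sub>R g (x, y))" for y
      by (simp add: h_def indicator_def)
    ultimately show ?thesis
      by (simp only: set_lebesgue_integral_def integral_scaleR_right)
  qed
  have int': "set_integrable lborel {a..b} (\<lambda>x. integral {c..d} (\<lambda>y. g (x, y)))"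
    using lborel_pair.integrable_fst'[OF h] unfolding slice set_integrable_def .
  then show "(\<lambda>x. integral {c..d} (\<lambda>y. g (x, y))) integrable_on {a..b}"
    by (rule set_borel_integral_eq_integral(1))
  have "integral (cbox (a, c) (b, d)) g = integral\<^sup>L (lborel \<Otimes>\<^sub>M lborel) h"
    using set_borel_integral_eq_integral(2)[OF int]
    by (simp add: lborel_prod set_lebesgue_integral_def h_def[abs_def])
  also have "\<dots> = (LINT x|lborel. LINT y|lborel. h (x, y))"
    by (rule lborel_pair.integral_fst'[OF h, symmetric])
  also have "\<dots> = integral {a..b} (\<lambda>x. integral {c..d} (\<lambda>y. g (x, y)))"
    unfolding slice using set_borel_integral_eq_integral(2)[OF int']
    by (simp add: set_lebesgue_integral_def)
  finally show "integral (cbox (a, c) (b, d)) g = integral {a..b} (\<lambda>x. integral {c..d} (\<lambda>y. g (x, y)))" .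
qed

lemma pringsheim_neq_bot [simp]: "pringsheim \<noteq> bot"
  by (simp add: pringsheim_def prod_filter_eq_bot)

lemma eventually_pringsheim_beyond:
  "\<forall>\<^sub>F (a, b, c, d) in pringsheim. a \<le> - N \<and> N \<le> b \<and> c \<le> - N \<and> N \<le> d"
proof -
  have "\<forall>\<^sub>F R in pringsheim. fst R \<le> - N \<and> N \<le> fst (snd R) \<and> fst (snd (snd R)) \<le> - N \<and> N \<le> snd (snd (snd R))"
    unfolding pringsheim_def
    by (intro eventually_prodI eventually_le_at_bot eventually_ge_at_top)
  then show ?thesis by (simp add: case_prod_unfold)
qed

section \<open>Boundedness and measurability of f\<close>

context
  fixes f :: "real \<times> real \<Rightarrow> real"
  assumes f0: "f \<in> BV_0"
begin

text \<open>A second passage to infinity, now along the vertical line through the point, turns the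
  increment bound into a bound for the value. It gives global boundedness and, for x far out,
  smallness.\<close>

lemma abs_le_varm:
  "\<bar>f (x, y)\<bar> \<le> varm f ({x<..} \<times> UNIV)" "\<bar>f (x, y)\<bar> \<le> varm f ({..x} \<times> UNIV)"
proof -
  have "((\<lambda>y'. \<bar>f (x, y') - f (x, y)\<bar>) \<longlongrightarrow> \<bar>0 - f (x, y)\<bar>) at_top"
    by (intro tendsto_intros lines_vanish[OF f0] at_top_le_at_infinity)
  moreover have "\<forall>\<^sub>F y' in at_top. \<bar>f (x, y') - f (x, y)\<bar> \<le> varm f ({x<..} \<times> UNIV)"
    using eventually_ge_at_top[of y]
  proof eventually_elim
    case (elim y')
    show ?case
      by (rule order_trans[OF line_increment_y(1)[OF f0 elim] varm_mono[OF bv[OF f0]]]) auto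
  qed
  ultimately have "\<bar>0 - f (x, y)\<bar> \<le> varm f ({x<..} \<times> UNIV)"
    by (rule tendsto_upperbound) simp
  then show "\<bar>f (x, y)\<bar> \<le> varm f ({x<..} \<times> UNIV)" by simp
  have "((\<lambda>y'. \<bar>f (x, y') - f (x, y)\<bar>) \<longlongrightarrow> \<bar>0 - f (x, y)\<bar>) at_top"
    by (intro tendsto_intros lines_vanish[OF f0] at_top_le_at_infinity)
  moreover have "\<forall>\<^sub>F y' in at_top. \<bar>f (x, y') - f (x, y)\<bar> \<le> varm f ({..x} \<times> UNIV)"
    using eventually_ge_at_top[of y]
  proof eventually_elim
    case (elim y')
    show ?case
      by (rule order_trans[OF line_increment_y(2)[OF f0 elim] varm_mono[OF bv[OF f0]]]) auto
  qed
  ultimately have "\<bar>0 - f (x, y)\<bar> \<le> varm f ({..x} \<times> UNIV)"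
    by (rule tendsto_upperbound) simp
  then show "\<bar>f (x, y)\<bar> \<le> varm f ({..x} \<times> UNIV)" by simp
qed

lemma BV_0_borel_measurable: "f \<in> borel_measurable borel"
proof -
  \<comment> \<open>These are \<open>varm\<close> of a left and of a lower half-plane. The
    half-strip over \<open>{s<..t}\<close> that bounds an increment of f fits between two such
    half-planes.\<close>
  define \<phi> where "\<phi> x = varm f ({..x} \<times> UNIV)" for x
  define \<psi> where "\<psi> y = varm f (UNIV \<times> {..y})" for y
  have "mono \<phi>" "mono \<psi>"
    unfolding \<phi>_def \<psi>_def by (auto intro!: monoI varm_mono[OF bv[OF f0]])
  then have meas: "\<phi> \<in> borel_measurable borel" "\<psi> \<in> borel_measurable borel"
    by (simp_all add: borel_measurable_mono)
  have X': "\<bar>f (t, y) - f (s, y)\<bar> \<le> \<phi> t - \<phi> s" if "s \<le> t" for s t y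
  proof -
    have "\<phi> s + varm f ({s<..t} \<times> {y<..}) \<le> \<phi> t"
      unfolding \<phi>_def using that by (intro varm_superadd_le[OF bv[OF f0]]) auto
    then show ?thesis using line_increment_x(1)[OF f0 that, of y] by linarith
  qed
  have X: "\<bar>f (t, y) - f (s, y)\<bar> \<le> \<bar>\<phi> t - \<phi> s\<bar>" for s t y
    using X'[of s t y] X'[of t s y] by (cases "s \<le> t") (simp_all add: abs_minus_commute)
  have Y': "\<bar>f (x, t) - f (x, s)\<bar> \<le> \<psi> t - \<psi> s" if "s \<le> t" for s t x
  proof -
    have "\<psi> s + varm f ({x<..} \<times> {s<..t}) \<le> \<psi> t"
      unfolding \<psi>_def using that by (intro varm_superadd_le[OF bv[OF f0]]) auto
    then show ?thesis using line_increment_y(1)[OF f0 that, of x] by linarith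
  qed
  have Y: "\<bar>f (x, t) - f (x, s)\<bar> \<le> \<bar>\<psi> t - \<psi> s\<bar>" for s t x
    using Y'[of s t x] Y'[of t s x] by (cases "s \<le> t") (simp_all add: abs_minus_commute)
  show ?thesis
  \<comment> \<open>The constant 2 arises because each of the two coordinate distances is at most
    the Euclidean distance of the pairs.\<close>
  proof (rule borel_measurable_Lipschitz_factor[where C = 2])
    show "(\<lambda>p. (\<phi> (fst p), \<psi> (snd p))) \<in> borel_measurable borel"
      by (intro borel_measurable_Pair measurable_compose[OF _ meas(1)] measurable_compose[OF _ meas(2)]
          borel_measurable_continuous_onI continuous_intros)
    show "dist (f p) (f q) \<le> 2 * dist (\<phi> (fst p), \<psi> (snd p)) (\<phi> (fst q), \<psi> (snd q))" for p q
    proof -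
      obtain x y where p: "p = (x, y)" by (cases p)
      obtain x' y' where q: "q = (x', y')" by (cases q)
      have "\<bar>f (x, y) - f (x', y')\<bar> \<le> \<bar>\<phi> x - \<phi> x'\<bar> + \<bar>\<psi> y - \<psi> y'\<bar>"
        using X[of x y x'] Y[of x' y y'] by linarith
      moreover have "\<bar>\<phi> x - \<phi> x'\<bar> \<le> dist (\<phi> x, \<psi> y) (\<phi> x', \<psi> y')"
        "\<bar>\<psi> y - \<psi> y'\<bar> \<le> dist (\<phi> x, \<psi> y) (\<phi> x', \<psi> y')"
        using dist_fst_le[of "(\<phi> x, \<psi> y)" "(\<phi> x', \<psi> y')"] dist_snd_le[of "(\<phi> x, \<psi> y)" "(\<phi> x', \<psi> y')"]
        by (simp_all add: dist_real_def)
      ultimately show ?thesis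
        unfolding p q fst_conv snd_conv dist_real_def[of "f _"] by linarith
    qed
  qed
qed

lemma KP_Fubini:
  shows "(\<lambda>t. complex_of_real (f t) * fourier_kernel \<xi> \<eta> t) integrable_on cbox (a, c) (b, d)"
    and "(\<lambda>x. osc \<xi> x * integral {c..d} (\<lambda>y. osc \<eta> y * f (x, y))) integrable_on {a..b}"
    and "KP_partial f \<xi> \<eta> (a, b, c, d)
      = integral {a..b} (\<lambda>x. osc \<xi> x * integral {c..d} (\<lambda>y. osc \<eta> y * f (x, y)))"
proof -
  define g where "g t = complex_of_real (f t) * fourier_kernel \<xi> \<eta> t" for t
  have fk: "fourier_kernel \<xi> \<eta> = (\<lambda>p. osc \<xi> (fst p) * osc \<eta> (snd p))"
    by (rule ext) (metis fourier_kernel_eq prod.collapse)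
  have "fourier_kernel \<xi> \<eta> \<in> borel_measurable borel"
    unfolding fk
    by (intro borel_measurable_continuous_onI continuous_intros
        continuous_on_compose2[OF continuous_on_osc[of UNIV]] subset_UNIV)
  then have meas: "g \<in> borel_measurable borel"
    unfolding g_def using BV_0_borel_measurable by (intro borel_measurable_times) simp_all
  have bound: "norm (g p) \<le> varm f UNIV" for p
  proof -
    obtain x y where p: "p = (x, y)" by (cases p)
    have "\<bar>f (x, y)\<bar> \<le> varm f UNIV"
      using abs_le_varm(1)[of x y] varm_mono[OF bv[OF f0], of "{x<..} \<times> UNIV" UNIV] by simp
    then show ?thesis by (simp add: g_def p fourier_kernel_eq norm_mult)
  qed
  have slice: "integral {c..d} (\<lambda>y. g (x, y)) = osc \<xi> x * integral {c..d} (\<lambda>y. osc \<eta> y * f (x, y))" for x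
    by (simp add: g_def fourier_kernel_eq mult_ac flip: integral_mult_right)
  note F = integral_cbox_Fubini[OF meas bound, where a = a and b = b and c = c and d = d, unfolded slice]
  show "(\<lambda>t. complex_of_real (f t) * fourier_kernel \<xi> \<eta> t) integrable_on cbox (a, c) (b, d)"
    using F(1) by (simp only: g_def)
  show "(\<lambda>x. osc \<xi> x * integral {c..d} (\<lambda>y. osc \<eta> y * f (x, y))) integrable_on {a..b}"
    by (rule F(2))
  show "KP_partial f \<xi> \<eta> (a, b, c, d)
      = integral {a..b} (\<lambda>x. osc \<xi> x * integral {c..d} (\<lambda>y. osc \<eta> y * f (x, y)))"
    using F(3) by (simp add: KP_partial_def g_def)
qed

section \<open>Integration by parts in two variables\<close>

text \<open>\<open>H y\<close> equals \<open>\<i> * \<xi>\<close> times the integral of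
  \<open>osc \<xi> x * f (x, y)\<close> over \<open>{a..b}\<close>. It is written through
  \<open>stj\<close> and two corner values because these have bounds by \<open>varm\<close> that do
  not grow with \<open>b - a\<close>.\<close>

lemma stj2_by_parts:
  fixes \<xi> \<eta> a b c d :: real
  defines "H \<equiv> \<lambda>y. stj \<xi> a b (\<lambda>x. complex_of_real (f (x, y)))
      - osc \<xi> b * f (b, y) + osc \<xi> a * f (a, y)"
  shows "stj2 \<xi> \<eta> f (a, b, c, d) = osc \<xi> b * stj_inner \<eta> f c d b - osc \<xi> a * stj_inner \<eta> f c d a
    + osc \<eta> d * H d - osc \<eta> c * H c - complex_of_real (\<xi> * \<eta>) * KP_partial f \<xi> \<eta> (a, b, c, d)"
proof -
  define J where "J x = integral {c..d} (\<lambda>y. osc \<eta> y * f (x, y))" for x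
  define L where "L y = integral {a..b} (\<lambda>x. osc \<xi> x * f (x, y))" for y
  have L: "((\<lambda>x. osc \<xi> x * f (x, y)) has_integral L y) {a..b}" for y
    unfolding L_def by (intro integrable_integral controls_integrable[OF line_controls_x(1)[OF f0]])
  have K: "((\<lambda>x. osc \<xi> x * J x) has_integral KP_partial f \<xi> \<eta> (a, b, c, d)) {a..b}"
    unfolding KP_Fubini(3) J_def by (intro integrable_integral KP_Fubini(2))
  have inner: "osc \<xi> x * stj_inner \<eta> f c d x = osc \<eta> d * (osc \<xi> x * f (x, d))
      - osc \<eta> c * (osc \<xi> x * f (x, c)) + \<i> * \<eta> * (osc \<xi> x * J x)" for x
    unfolding stj_inner_def stj_def J_def by algebra
  have "((\<lambda>x. osc \<xi> x * stj_inner \<eta> f c d x) has_integral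
      (osc \<eta> d * L d - osc \<eta> c * L c + \<i> * \<eta> * KP_partial f \<xi> \<eta> (a, b, c, d))) {a..b}"
    unfolding inner by (intro has_integral_add has_integral_diff has_integral_mult_right L K)
  then have I: "integral {a..b} (\<lambda>x. osc \<xi> x * stj_inner \<eta> f c d x)
      = osc \<eta> d * L d - osc \<eta> c * L c + \<i> * \<eta> * KP_partial f \<xi> \<eta> (a, b, c, d)"
    by (rule integral_unique)
  have H: "H y = \<i> * \<xi> * L y" for y
    unfolding H_def stj_def L_def by algebra
  \<comment> \<open>One factor \<i> comes from each integration by parts; their product is the
    source of the minus sign in the transform formula.\<close>
  have "\<i> * \<i> = (- 1 :: complex)" by simp
  then show ?thesis
    unfolding H stj2.simps stj_def[of \<xi>] I of_real_mult by algebra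
qed

text \<open>The vertical edges contribute one unit each, the horizontal edges three each: one for
  the edge integral and two for its corners. For every edge the half-strip on its outer side is
  used, which misses the square.\<close>

lemma by_parts_remainder:
  assumes N: "0 < N" and R: "a \<le> - N" "N \<le> b" "c \<le> - N" "N \<le> d"
  shows "norm (stj2 \<xi> \<eta> f (a, b, c, d) + complex_of_real (\<xi> * \<eta>) * KP_partial f \<xi> \<eta> (a, b, c, d))
    \<le> 8 * varm f (- ({- N<..N} \<times> {- N<..N}))"
proof -
  let ?T = "varm f (- ({- N<..N} \<times> {- N<..N}))"
  have le: "a \<le> b" "c \<le> d" using N R by linarith+
  have T: "varm f S \<le> ?T" if "S \<inter> {- N<..N} \<times> {- N<..N} = {}" for S
    using that by (intro varm_mono[OF bv[OF f0]]) auto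
  define Hd where "Hd = stj \<xi> a b (\<lambda>x. complex_of_real (f (x, d)))"
  define Hc where "Hc = stj \<xi> a b (\<lambda>x. complex_of_real (f (x, c)))"
  have Ib: "norm (stj_inner \<eta> f c d b) \<le> ?T"
    using norm_stj_le[OF line_controls_y(1)[OF f0] le(2), of \<eta> b] R
      T[of "{b<..} \<times> {c<..d}"] by (fastforce simp: stj_inner_def varm_empty[OF bv[OF f0]])
  have Ia: "norm (stj_inner \<eta> f c d a) \<le> ?T"
    using norm_stj_le[OF line_controls_y(2)[OF f0] le(2), of \<eta> a] R
      T[of "{..a} \<times> {c<..d}"] by (fastforce simp: stj_inner_def varm_empty[OF bv[OF f0]])
  have Hd: "norm Hd \<le> ?T"
    using norm_stj_le[OF line_controls_x(1)[OF f0] le(1), of \<xi> d] R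
      T[of "{a<..b} \<times> {d<..}"] by (fastforce simp: Hd_def varm_empty[OF bv[OF f0]])
  have Hc: "norm Hc \<le> ?T"
    using norm_stj_le[OF line_controls_x(2)[OF f0] le(1), of \<xi> c] R
      T[of "{a<..b} \<times> {..c}"] by (fastforce simp: Hc_def varm_empty[OF bv[OF f0]])
  have fb: "\<bar>f (b, y)\<bar> \<le> ?T" for y
    by (rule order_trans[OF abs_le_varm(1) T]) (use R in auto)
  have fa: "\<bar>f (a, y)\<bar> \<le> ?T" for y
    by (rule order_trans[OF abs_le_varm(2) T]) (use R in auto)
  have H: "norm (h - osc \<xi> b * f (b, y) + osc \<xi> a * f (a, y)) \<le> 3 * ?T" if "norm h \<le> ?T" for h y
  proof -
    have "norm (h - osc \<xi> b * f (b, y) + osc \<xi> a * f (a, y))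
        \<le> norm h + norm (osc \<xi> b * f (b, y)) + norm (osc \<xi> a * f (a, y))"
      by (intro order_trans[OF norm_triangle_ineq] add_right_mono norm_triangle_ineq4)
    also have "\<dots> = norm h + \<bar>f (b, y)\<bar> + \<bar>f (a, y)\<bar>"
      by (simp add: norm_mult)
    finally show ?thesis using that fa[of y] fb[of y] by linarith
  qed
  define G1 where "G1 = Hd - osc \<xi> b * f (b, d) + osc \<xi> a * f (a, d)"
  define G2 where "G2 = Hc - osc \<xi> b * f (b, c) + osc \<xi> a * f (a, c)"
  have G: "norm G1 \<le> 3 * ?T" "norm G2 \<le> 3 * ?T"
    unfolding G1_def G2_def by (intro H Hd Hc)+
  have "stj2 \<xi> \<eta> f (a, b, c, d) + complex_of_real (\<xi> * \<eta>) * KP_partial f \<xi> \<eta> (a, b, c, d)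
      = osc \<xi> b * stj_inner \<eta> f c d b - osc \<xi> a * stj_inner \<eta> f c d a + osc \<eta> d * G1 - osc \<eta> c * G2"
    unfolding stj2_by_parts G1_def G2_def Hd_def Hc_def by simp
  also have "norm \<dots> \<le> norm (osc \<xi> b * stj_inner \<eta> f c d b) + norm (osc \<xi> a * stj_inner \<eta> f c d a)
      + norm (osc \<eta> d * G1) + norm (osc \<eta> c * G2)"
    by (intro order_trans[OF norm_triangle_ineq4] order_trans[OF norm_triangle_ineq]
        add_right_mono norm_triangle_ineq4)
  also have "\<dots> = norm (stj_inner \<eta> f c d b) + norm (stj_inner \<eta> f c d a) + norm G1 + norm G2"
    by (simp add: norm_mult)
  finally show ?thesis using Ia Ib G by linarith
qed

section \<open>Pringsheim limits\<close>

text \<open>Removing the square leaves two side strips of full height and two pieces above and below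
  the square; each lies outside the square and contributes at most one tail.\<close>

lemma stj2_beyond:
  assumes N: "0 < N" and R: "a \<le> - N" "N \<le> b" "c \<le> - N" "N \<le> d"
  shows "norm (stj2 \<xi> \<eta> f (a, b, c, d) - stj2 \<xi> \<eta> f (- N, N, - N, N))
    \<le> 4 * varm f (- ({- N<..N} \<times> {- N<..N}))"
proof -
  let ?A = "stj2 \<xi> \<eta> f" and ?T = "varm f (- ({- N<..N} \<times> {- N<..N}))"
  have T: "norm (?A (s, t, u, v)) \<le> ?T"
    if "s \<le> t" "u \<le> v" "({s<..t} \<times> {u<..v}) \<inter> {- N<..N} \<times> {- N<..N} = {}" for s t u v
    using norm_stj2_le[OF f0 that(1,2), of \<xi> \<eta>] that(3)
      varm_mono[OF bv[OF f0], of "{s<..t} \<times> {u<..v}" "- ({- N<..N} \<times> {- N<..N})"]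
    by (meson disjoint_eq_subset_Compl order_trans)
  have "?A (a, b, c, d) = ?A (a, - N, c, d) + (?A (- N, N, c, d) + ?A (N, b, c, d))"
    using stj2_combine_x[OF f0, of a "- N" b c d \<xi> \<eta>] stj2_combine_x[OF f0, of "- N" N b c d \<xi> \<eta>] N R
    by simp
  moreover have "?A (- N, N, c, d) = ?A (- N, N, c, - N) + (?A (- N, N, - N, N) + ?A (- N, N, N, d))"
    using stj2_combine_y[OF f0, of c "- N" d \<xi> \<eta> "- N" N] stj2_combine_y[OF f0, of "- N" N d \<xi> \<eta> "- N" N] N R
    by simp
  ultimately have "?A (a, b, c, d) - ?A (- N, N, - N, N)
      = ?A (a, - N, c, d) + ?A (N, b, c, d) + ?A (- N, N, c, - N) + ?A (- N, N, N, d)"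
    by (simp only: algebra_simps)
  also have "norm \<dots> \<le> norm (?A (a, - N, c, d)) + norm (?A (N, b, c, d))
      + norm (?A (- N, N, c, - N)) + norm (?A (- N, N, N, d))"
    by (intro order_trans[OF norm_triangle_ineq] add_right_mono norm_triangle_ineq)
  also have "\<dots> \<le> ?T + ?T + ?T + ?T"
    using N R by (intro add_mono T) auto
  finally show ?thesis by simp
qed

lemma stj2_convergent: "\<exists>L. (stj2 \<xi> \<eta> f \<longlongrightarrow> L) pringsheim"
proof -
  have "cauchy_filter (filtermap (stj2 \<xi> \<eta> f) pringsheim)"
    unfolding cauchy_filter_metric_filtermap
  proof (intro allI impI)
    fix e :: real assume "0 < e"
    \<comment> \<open>Four tails of size \<open>e / 8\<close> bring each value within
      \<open>e / 2\<close> of the value on the central square, hence any two within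
      \<open>e\<close>.\<close>
    then have "0 < e / 8" by simp
    then obtain N where N: "0 < N" "varm f (- ({- N<..N} \<times> {- N<..N})) < e / 8"
      by (rule varm_tail[OF bv[OF f0]])
    define P where "P = (\<lambda>(a, b, c, d). a \<le> - N \<and> N \<le> b \<and> c \<le> - N \<and> N \<le> d)"
    have close: "dist (stj2 \<xi> \<eta> f R) (stj2 \<xi> \<eta> f (- N, N, - N, N)) < e / 2" if "P R" for R
    proof -
      obtain a b c d where R: "R = (a, b, c, d)" by (cases R)
      show ?thesis
        using stj2_beyond[OF N(1), of a b c d \<xi> \<eta>] that N(2) unfolding R P_def dist_norm by simp
    qed
    have "eventually P pringsheim"
      unfolding P_def by (rule eventually_pringsheim_beyond)
    moreover have "\<forall>R S. P R \<and> P S \<longrightarrow> dist (stj2 \<xi> \<eta> f R) (stj2 \<xi> \<eta> f S) < e"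
      using close dist_triangle_half_l by blast
    ultimately show "\<exists>P. eventually P pringsheim \<and>
        (\<forall>R S. P R \<and> P S \<longrightarrow> dist (stj2 \<xi> \<eta> f R) (stj2 \<xi> \<eta> f S) < e)"
      by blast
  qed
  from cauchy_filter_complete_converges[OF this complete_UNIV] show ?thesis
    by (simp add: filterlim_def filtermap_bot_iff)
qed

text \<open>Together with the convergence of \<open>stj2\<close> this yields the existence of the
  limit of \<open>KP_partial\<close>, not only its value.\<close>

lemma by_parts_remainder_tendsto:
  "((\<lambda>R. stj2 \<xi> \<eta> f R + complex_of_real (\<xi> * \<eta>) * KP_partial f \<xi> \<eta> R) \<longlongrightarrow> 0) pringsheim"
proof (rule tendstoI)
  fix e :: real assume "0 < e"
  then have "0 < e / 8" by simp
  then obtain N where N: "0 < N" "varm f (- ({- N<..N} \<times> {- N<..N})) < e / 8"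
    by (rule varm_tail[OF bv[OF f0]])
  show "\<forall>\<^sub>F R in pringsheim. dist (stj2 \<xi> \<eta> f R + complex_of_real (\<xi> * \<eta>) * KP_partial f \<xi> \<eta> R) 0 < e"
    using eventually_pringsheim_beyond[of N]
  proof eventually_elim
    case (elim R)
    obtain a b c d where R: "R = (a, b, c, d)" by (cases R)
    show ?case
      using by_parts_remainder[OF N(1), of a b c d \<xi> \<eta>] elim N(2) unfolding R by simp
  qed
qed

end

theorem theorem3p4:
  fixes f :: "real \<times> real \<Rightarrow> real"
  assumes "f \<in> BV_0"
  shows "\<forall>\<xi> \<eta>. \<xi> \<noteq> 0 \<longrightarrow> \<eta> \<noteq> 0 \<longrightarrow>
    KP_fourier_well_defined f \<xi> \<eta> \<and>
    improper_RS_integrable (fourier_kernel \<xi> \<eta>) f \<and>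
    KP_fourier f \<xi> \<eta> =
      - (1 / complex_of_real (\<xi> * \<eta>)) * improper_RS_integral (fourier_kernel \<xi> \<eta>) f"
proof (intro allI impI)
  fix \<xi> \<eta> :: real assume nz: "\<xi> \<noteq> 0" "\<eta> \<noteq> 0"
  define z where "z = complex_of_real (\<xi> * \<eta>)"
  have z: "z \<noteq> 0" using nz by (simp add: z_def)
  obtain L where L: "(stj2 \<xi> \<eta> f \<longlongrightarrow> L) pringsheim"
    using stj2_convergent[OF assms] by blast
  have RS: "RS_integral (fourier_kernel \<xi> \<eta>) f R = stj2 \<xi> \<eta> f R" if "R \<in> rects" for R
    by (rule RS_integral_eq[OF has_RS_integral_stj2[OF assms that] that])
  \<comment> \<open>The integral is identified only on nondegenerate rectangles; the bound 1 gives
    \<open>a \<le> -1\<close> and \<open>1 \<le> b\<close>, and likewise for c and d, so eventually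
    all rectangles are of this kind.\<close>
  have "\<forall>\<^sub>F R in pringsheim. stj2 \<xi> \<eta> f R = RS_integral (fourier_kernel \<xi> \<eta>) f R"
    using eventually_pringsheim_beyond[of 1]
    by eventually_elim (auto simp: rects_def intro!: RS[symmetric])
  from Lim_transform_eventually[OF L this]
  have lim_RS: "(RS_integral (fourier_kernel \<xi> \<eta>) f \<longlongrightarrow> L) pringsheim" .
  \<comment> \<open>Subtracting \<open>stj2\<close> from the remainder leaves
    \<open>z * KP_partial\<close>, and division by the nonzero \<open>z\<close> isolates the partial
    transform.\<close>
  have "((\<lambda>R. (stj2 \<xi> \<eta> f R + complex_of_real (\<xi> * \<eta>) * KP_partial f \<xi> \<eta> R - stj2 \<xi> \<eta> f R) / z) \<longlongrightarrow> (0 - L) / z) pringsheim"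
    by (intro tendsto_intros by_parts_remainder_tendsto[OF assms] L z)
  then have lim_KP: "(KP_partial f \<xi> \<eta> \<longlongrightarrow> - L / z) pringsheim"
    using nz by (simp add: z_def)
  have "KP_fourier_well_defined f \<xi> \<eta>"
    unfolding KP_fourier_well_defined_def using KP_Fubini(1)[OF assms] lim_KP by blast
  moreover have "improper_RS_integrable (fourier_kernel \<xi> \<eta>) f"
    unfolding improper_RS_integrable_def RS_integrable_def
    using has_RS_integral_stj2[OF assms] lim_RS by blast
  moreover have "KP_fourier f \<xi> \<eta> = - (1 / z) * improper_RS_integral (fourier_kernel \<xi> \<eta>) f"
    unfolding KP_fourier_def improper_RS_integral_def
      tendsto_Lim[OF pringsheim_neq_bot lim_KP] tendsto_Lim[OF pringsheim_neq_bot lim_RS]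
    by simp
  ultimately show "KP_fourier_well_defined f \<xi> \<eta> \<and>
      improper_RS_integrable (fourier_kernel \<xi> \<eta>) f \<and>
      KP_fourier f \<xi> \<eta> =
        - (1 / complex_of_real (\<xi> * \<eta>)) * improper_RS_integral (fourier_kernel \<xi> \<eta>) f"
    unfolding z_def by blast
qed

end
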